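(* Let $d\geq 2$ and $k\in\{1,\ldots,d-1\}$. A finite simple graph $G=(V,E)$ is $(d,k)$-rigid if and only if either $G$ is a complete graph, or $G$ contains a spanning subgraph that is $(d-k)$-rigid and $|E|\geq (d-k)|V|-\binom{d-k+1}{2}+k$.
   Context: A framework $(G,p)$ with $p:V\to\mathbb{R}^d$ is generic if the coordinates of the points $p(v)$, $v\in V$, are distinct and algebraically independent over $\mathbb{Q}$. $p_i$ denotes the $i$-th coordinate of $p$. Fix $v_0\in V$. The matrix $J_{v_0}(G,p)$ (defined when $p_i(v_0)\neq0$ for $i\in\{d-k+1,\ldots,d\}$) has rows indexed by edges $vw\in E$ and by pairs $(v,i)$, $v\in V\setminus\{v_0\}$, $i\in\{d-k+1,\ldots,d\}$, and columns indexed by pairs $(u,j)$, $u\in V$, $j\in\{1,\ldots,d\}$; the edge row $vw$ has $p_j(v)-p_j(w)$ in column $(v,j)$ and $p_j(w)-p_j(v)$ in column $(w,j)$ for all $j$, zeros elsewhere; row $(v,i)$ has $1/p_i(v_0)$ in column $(v,i)$, $-p_i(v)/p_i(v_0)^2$ in column $(v_0,i)$, zeros elsewhere. $(G,p)$ is infinitesimally $(d,k)$-rigid if either $G$ is complete and $\{p(v)\}$ has affine dimension $\min\{d,|V|-1\}$, or $G$ is not complete and $\operatorname{rank}J_{v_0}(G,p)=d|V|-\binom{d-k+1}{2}$. A graph $G$ is $(d,k)$-rigid if some realisation $p:V\to\mathbb{R}^d$ makes $(G,p)$ infinitesimally $(d,k)$-rigid (equivalently, every generic $(G,p)$ in $\mathbb{R}^d$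 is). A graph is $m$-rigid if a (equivalently every) generic framework of it in $\mathbb{R}^m$ is rigid in the usual bar-joint sense (every equivalent framework in a neighbourhood is obtained by an isometry of $\mathbb{R}^m$).
   Formalization: Proved under the added assumption that G is complete or |V| ≥ d−k−1; without it the claim fails, e.g. d=6, k=1, three vertices and one edge: rank J = 3 = 6·3 − C(6,2), yet G is neither complete nor has a 5-rigid spanning subgraph. *)

theory Defs
  imports "HOL-Analysis.Analysis"
begin

text \<open>
  A finite simple graph has the finite type \<^typ>\<open>'v\<close> as its vertex set and is given by its
  set of edges, which are two-element subsets of \<^typ>\<open>'v\<close>.
\<close>

definition simple_graph :: "'v::finite set set \<Rightarrow> bool" where
  "simple_graph E \<longleftrightarrow> (\<forall>e\<in>E. card e = 2)"

definition complete_graph :: "'v::finite set set \<Rightarrow> bool" where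
  "complete_graph E \<longleftrightarrow> E = {e. card e = 2}"

text \<open>
  Algebraic independence over the rationals of a finite family of reals. A polynomial in the
  indeterminates indexed by \<^typ>\<open>'i\<close> is its finitely supported coefficient function on exponent
  vectors. Since this is independence of the family rather than of its range, the members of an
  independent family are distinct.
\<close>

definition alg_indep_over_rat :: "('i::finite \<Rightarrow> real) \<Rightarrow> bool" where
  "alg_indep_over_rat x \<longleftrightarrow>
     (\<forall>c :: ('i \<Rightarrow> nat) \<Rightarrow> rat.
        finite {a. c a \<noteq> 0} \<longrightarrow>
        (\<Sum>a | c a \<noteq> 0. of_rat (c a) * (\<Prod>i\<in>UNIV. x i ^ a i)) = 0 \<longrightarrow>
        (\<forall>a. c a = 0))"

definition generic :: "('v::finite \<Rightarrow> real ^ 'n::finite) \<Rightarrow> bool" where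
  "generic p \<longleftrightarrow> alg_indep_over_rat (\<lambda>(v, i). p v $ i)"

definition equivalent_frameworks ::
  "'v::finite set set \<Rightarrow> ('v \<Rightarrow> real ^ 'n::finite) \<Rightarrow> ('v \<Rightarrow> real ^ 'n) \<Rightarrow> bool" where
  "equivalent_frameworks E p q \<longleftrightarrow>
     (\<forall>v w. {v, w} \<in> E \<longrightarrow> dist (p v) (p w) = dist (q v) (q w))"

definition rigid_framework :: "'v::finite set set \<Rightarrow> ('v \<Rightarrow> real ^ 'n::finite) \<Rightarrow> bool" where
  "rigid_framework E p \<longleftrightarrow>
     (\<exists>\<epsilon>>0. \<forall>q. (\<forall>v. dist (p v) (q v) < \<epsilon>) \<and> equivalent_frameworks E p q \<longrightarrow>
        (\<exists>T. (\<forall>x y. dist (T x) (T y) = dist x y) \<and> (\<forall>v. q v = T (p v))))"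

definition graph_rigid :: "'n::finite itself \<Rightarrow> 'v::finite set set \<Rightarrow> bool" where
  "graph_rigid (_ :: 'n itself) E \<longleftrightarrow>
     (\<exists>p :: 'v \<Rightarrow> real ^ 'n. generic p \<and> rigid_framework E p)"

text \<open>
  The coordinates of \<open>\<real>\<^sup>d\<close> are indexed by \<^typ>\<open>'m + 'k\<close>, where \<^typ>\<open>'m\<close> has \<open>d - k\<close> elements and
  \<^typ>\<open>'k\<close> has \<open>k\<close> elements: the left summand stands for the coordinates \<open>1, \<dots>, d - k\<close> and the
  right summand for \<open>d - k + 1, \<dots>, d\<close>.

  \<open>J_row v0 p r\<close> is the row with index \<open>r\<close> of the matrix \<open>J\<close>. For an edge \<open>e = {u, w}\<close> the sum over
  \<open>e\<close> has only one possibly nonzero term, namely \<open>p u $ j - p w $ j\<close>.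
\<close>

definition J_row ::
  "'v::finite \<Rightarrow> ('v \<Rightarrow> real ^ ('m::finite + 'k::finite)) \<Rightarrow> 'v set + 'v \<times> 'k \<Rightarrow>
     real ^ ('v \<times> ('m + 'k))" where
  "J_row v0 p r =
     (case r of
        Inl e \<Rightarrow> (\<chi> c. case c of (u, j) \<Rightarrow> if u \<in> e then \<Sum>w\<in>e. p u $ j - p w $ j else 0)
      | Inr (v, i) \<Rightarrow> (\<chi> c.
          if c = (v, Inr i) then 1 / p v0 $ Inr i
          else if c = (v0, Inr i) then - (p v $ Inr i) / (p v0 $ Inr i)\<^sup>2
          else 0))"

lemma J_row_edge:
  assumes "v \<noteq> w"
  shows "J_row v0 p (Inl {v, w}) $ (u, j) =
    (if u = v then p v $ j - p w $ j else if u = w then p w $ j - p v $ j else 0)"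
  using assms by (auto simp: J_row_def)

definition J_row_indices :: "'v::finite \<Rightarrow> 'v set set \<Rightarrow> ('v set + 'v \<times> 'k::finite) set" where
  "J_row_indices v0 E = E <+> (UNIV - {v0}) \<times> UNIV"

definition J_rank ::
  "'v::finite \<Rightarrow> 'v set set \<Rightarrow> ('v \<Rightarrow> real ^ ('m::finite + 'k::finite)) \<Rightarrow> nat" where
  "J_rank v0 E p = dim (J_row v0 p ` J_row_indices v0 E)"

definition inf_dk_rigid ::
  "'v::finite \<Rightarrow> 'v set set \<Rightarrow> ('v \<Rightarrow> real ^ ('m::finite + 'k::finite)) \<Rightarrow> bool" where
  "inf_dk_rigid v0 E p \<longleftrightarrow>
     (if complete_graph E
      then aff_dim (range p) = int (min CARD('m + 'k) (CARD('v) - 1))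
      else (\<forall>i :: 'k. p v0 $ Inr i \<noteq> 0) \<and>
           int (J_rank v0 E p) =
             int CARD('m + 'k) * int CARD('v) - int ((CARD('m) + 1) choose 2))"

definition dk_rigid ::
  "'m::finite itself \<Rightarrow> 'k::finite itself \<Rightarrow> 'v::finite \<Rightarrow> 'v set set \<Rightarrow> bool" where
  "dk_rigid (_ :: 'm itself) (_ :: 'k itself) v0 E \<longleftrightarrow>
     (\<exists>p :: 'v \<Rightarrow> real ^ ('m + 'k). inf_dk_rigid v0 E p)"

end

theory Submission
  imports Defs "HOL-Computational_Algebra.Polynomial"
begin

text \<open>
  Write \<open>m = d - k\<close> and \<open>n = |V|\<close>. A vector in the kernel of \<open>J\<close> equals \<open>\<lambda>\<^sub>i p\<^sub>i\<close> in
  the coordinate \<open>i\<close> for each of the last \<open>k\<close> coordinates, so \<open>J\<close> has the required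
  rank iff the rigidity matrix in dimension \<open>m\<close>, extended by the \<open>k\<close> columns
  \<open>((p\<^sub>i v - p\<^sub>i w)\<^sup>2)\<close> indexed by the edges \<open>vw\<close>, has rank
  \<open>m n - (m + 1 choose 2) + k\<close>. Removing \<open>k\<close> columns loses rank at most \<open>k\<close>, which gives the
  forward direction. Conversely, the vectors \<open>((f v - f w)\<^sup>2)\<close> span the whole of \<open>\<real>\<^sup>E\<close>, because a
  weighted graph Laplacian vanishes only if all weights do; hence each new column can be chosen to
  raise the rank as long as the rank is less than \<open>|E|\<close>.

  Generic rigidity is compared with the rank of the rigidity matrix as by Asimow and Roth: a generic
  configuration maximises the rank of every set of rows, so that the constant rank theorem describes
  the fibre of the squared edge lengths near it.
\<close>

section \<open>Linear algebra\<close>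

lemma dim_orthogonal_comp:
  fixes S :: "'a::euclidean_space set"
  shows "dim S + dim (S\<^sup>\<bottom>) = DIM('a)"
proof -
  have "S\<^sup>\<bottom> = {z \<in> UNIV. \<forall>s\<in>span S. orthogonal s z}"
    unfolding orthogonal_comp_def
    by (auto intro: span_base) (meson orthogonal_commute orthogonal_to_span)
  then show ?thesis
    using dim_subspace_orthogonal_to_vectors[of "span S" UNIV] by simp
qed

lemma linear_on_spanning_family:
  fixes a :: "'i::finite \<Rightarrow> 'a::euclidean_space" and b :: "'i \<Rightarrow> 'b::real_vector"
  assumes span: "span (range a) = UNIV"
    and relations: "\<And>c. (\<Sum>i\<in>UNIV. c i *\<^sub>R a i) = 0 \<Longrightarrow> (\<Sum>i\<in>UNIV. c i *\<^sub>R b i) = 0"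
  obtains L where "linear L" "\<And>i. L (a i) = b i"
proof -
  define A where "A c = (\<Sum>i\<in>UNIV. c $ i *\<^sub>R a i)" for c :: "real ^ 'i"
  define B where "B c = (\<Sum>i\<in>UNIV. c $ i *\<^sub>R b i)" for c :: "real ^ 'i"
  have A: "linear A" and B: "linear B"
    by (rule linearI; simp add: A_def B_def sum.distrib scaleR_left_distrib scaleR_sum_right)+
  have axis: "A (axis i 1) = a i" "B (axis i 1) = b i" for i
    by (simp_all add: A_def B_def axis_def if_distrib[of "\<lambda>s. s *\<^sub>R _"] cong: if_cong)
  have "range a \<subseteq> range A"
    by (metis axis(1) image_subsetI rangeI)
  then have "surj A"
    using span span_minimal[of "range a" "range A"] linear_subspace_image[OF A subspace_UNIV]
    by auto
  then obtain R where R: "linear R" "\<And>y. A (R y) = y"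
    using linear_surjective_right_inverse[OF A] by (auto simp: fun_eq_iff)
  have "B (R (a i)) = b i" for i
  proof -
    have "A (R (a i) - axis i 1) = 0"
      by (simp add: linear_diff[OF A] R(2) axis)
    then have "B (R (a i) - axis i 1) = 0"
      using relations unfolding A_def B_def by blast
    then show ?thesis
      by (simp add: linear_diff[OF B] axis)
  qed
  then show thesis
    using that[of "B \<circ> R"] linear_compose[OF R(1) B] by simp
qed

subsection \<open>Independent families\<close>

definition indep_family :: "'i set \<Rightarrow> ('i \<Rightarrow> 'a::real_vector) \<Rightarrow> bool" where
  "indep_family I r \<longleftrightarrow> inj_on r I \<and> independent (r ` I)"

lemma indep_familyI:
  assumes "finite I" and scalars: "\<And>c. (\<Sum>i\<in>I. c i *\<^sub>R r i) = 0 \<Longrightarrow> \<forall>i\<in>I. c i = 0"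
  shows "indep_family I r"
proof -
  have inj: "inj_on r I"
  proof (rule inj_onI, rule ccontr)
    fix i j assume ij: "i \<in> I" "j \<in> I" "r i = r j" "i \<noteq> j"
    let ?c = "\<lambda>x. if x = i then 1 else if x = j then - 1 else (0::real)"
    have "(\<Sum>x\<in>I. ?c x *\<^sub>R r x) = (\<Sum>x\<in>{i, j}. ?c x *\<^sub>R r x)"
      by (rule sum.mono_neutral_right) (use assms(1) ij in auto)
    also have "\<dots> = 0"
      using ij by auto
    finally show False
      using scalars ij(1) by fastforce
  qed
  moreover have "independent (r ` I)"
  proof (rule independent_if_scalars_zero)
    fix f x assume "(\<Sum>x\<in>r ` I. f x *\<^sub>R x) = 0" and "x \<in> r ` I"
    then show "f x = 0"
      using scalars[of "f \<circ> r"] by (auto simp: sum.reindex[OF inj])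
  qed (use assms(1) in simp)
  ultimately show ?thesis
    by (simp add: indep_family_def)
qed

lemma indep_familyD:
  assumes "indep_family I r" "finite I" "(\<Sum>i\<in>I. c i *\<^sub>R r i) = 0" "i \<in> I"
  shows "c i = 0"
proof -
  have inj: "inj_on r I" and ind: "independent (r ` I)"
    using assms(1) by (simp_all add: indep_family_def)
  let ?u = "\<lambda>y. c (inv_into I r y)"
  have "(\<Sum>y\<in>r ` I. ?u y *\<^sub>R y) = (\<Sum>i\<in>I. c i *\<^sub>R r i)"
    using inj by (subst sum.reindex) (auto intro!: sum.cong)
  then have "?u (r i) = 0"
    using ind assms(2-) by (intro independentD[of "r ` I" "r ` I"]) auto
  then show ?thesis
    using inj assms(4) by simp
qed

lemma indep_family_insert:
  assumes "e \<notin> J"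
  shows "indep_family (insert e J) r \<longleftrightarrow> indep_family J r \<and> r e \<notin> span (r ` J)"
  using assms span_superset[of "r ` J"] by (auto simp: indep_family_def independent_insert)

lemma indep_family_spanning_subset:
  fixes r :: "'i \<Rightarrow> 'a::euclidean_space"
  obtains J where "J \<subseteq> I" "indep_family J r" "r ` I \<subseteq> span (r ` J)"
proof -
  obtain B where B: "B \<subseteq> r ` I" "independent B" "r ` I \<subseteq> span B"
    using basis_exists[of "r ` I"] by metis
  moreover obtain J where "J \<subseteq> I" "inj_on r J" "B = r ` J"
    using B(1) by (auto simp: subset_image_inj)
  ultimately show thesis
    using that[of J] by (simp add: indep_family_def)
qed

lemma dim_indep_family:
  fixes r :: "'i \<Rightarrow> 'a::euclidean_space"
  assumes "indep_family J r"
  shows "dim (r ` J) = card J"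
  using assms by (simp add: indep_family_def dim_eq_card_independent card_image)

lemma indep_family_dual:
  fixes r :: "'i \<Rightarrow> 'a::euclidean_space"
  assumes "indep_family J r"
  obtains w where "\<And>i j. i \<in> J \<Longrightarrow> j \<in> J \<Longrightarrow> r i \<bullet> w j = (if i = j then 1 else 0)"
proof -
  have "\<exists>w. \<forall>i\<in>J. r i \<bullet> w = (if i = j then 1 else 0)" for j
  proof -
    have inj: "inj_on r J" and ind: "independent (r ` J)"
      using assms by (simp_all add: indep_family_def)
    obtain \<phi> :: "'a \<Rightarrow> real"
      where \<phi>: "linear \<phi>" "\<forall>x\<in>r ` J. \<phi> x = (if inv_into J r x = j then 1 else 0)"
      using linear_independent_extend[OF ind, of "\<lambda>x. if inv_into J r x = j then 1 else 0"] by auto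
    then have "r i \<bullet> adjoint \<phi> 1 = (if i = j then 1 else 0)" if "i \<in> J" for i
      using that inj by (simp add: adjoint_works)
    then show ?thesis by blast
  qed
  then obtain w where "\<And>j. \<forall>i\<in>J. r i \<bullet> w j = (if i = j then 1 else 0)"
    by metis
  then show thesis
    using that by blast
qed

lemma dim_add_column:
  fixes r :: "'i \<Rightarrow> 'a::euclidean_space"
  assumes relation: "(\<Sum>i\<in>I. \<omega> i *\<^sub>R r i) = 0" "(\<Sum>i\<in>I. \<omega> i * g i) \<noteq> 0"
    and a: "a \<notin> span (r ` I)"
  shows "dim ((\<lambda>i. r i + g i *\<^sub>R a) ` I) = dim (r ` I) + 1"
proof -
  let ?new = "(\<lambda>i. r i + g i *\<^sub>R a) ` I"
  define s where "s = (\<Sum>i\<in>I. \<omega> i * g i)"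
  have "s *\<^sub>R a = (\<Sum>i\<in>I. \<omega> i *\<^sub>R (r i + g i *\<^sub>R a))"
    by (simp add: scaleR_add_right sum.distrib relation(1) s_def scaleR_sum_left)
  also have "\<dots> \<in> span ?new"
    by (intro span_sum span_scale span_base) auto
  finally have "(1 / s) *\<^sub>R s *\<^sub>R a \<in> span ?new"
    by (rule span_scale)
  then have a_new: "a \<in> span ?new"
    using relation(2) by (simp add: s_def[symmetric])
  have "r i \<in> span ?new" if "i \<in> I" for i
  proof -
    have "(r i + g i *\<^sub>R a) - g i *\<^sub>R a \<in> span ?new"
      using that a_new by (intro span_diff span_scale) (auto intro: span_base)
    then show ?thesis by simp
  qed
  moreover have "r i + g i *\<^sub>R a \<in> span (insert a (r ` I))" if "i \<in> I" for i
    using that by (intro span_add span_scale) (auto intro: span_base)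
  ultimately have "span ?new = span (insert a (r ` I))"
    using a_new by (auto simp: span_eq)
  then have "dim ?new = dim (insert a (r ` I))"
    by (metis dim_span)
  then show ?thesis
    using a by (simp add: dim_insert)
qed

definition adjoin_columns ::
  "('i \<Rightarrow> 'a) \<Rightarrow> 'k::finite set \<Rightarrow> ('k \<Rightarrow> 'i \<Rightarrow> real) \<Rightarrow> 'i \<Rightarrow> 'a \<times> (real ^ 'k)" where
  "adjoin_columns r K G i = (r i, \<chi> k. if k \<in> K then G k i else 0)"

lemma dim_adjoin_columns_empty:
  fixes r :: "'i \<Rightarrow> 'a::euclidean_space"
  shows "dim (adjoin_columns r {} G ` I) = dim (r ` I)"
proof -
  have "adjoin_columns r {} G ` I = (\<lambda>z. (z, 0)) ` r ` I"
    by (auto simp: adjoin_columns_def image_image vec_eq_iff intro!: image_cong)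
  also have "dim \<dots> = dim (r ` I)"
    by (rule dim_image_eq) (auto simp: inj_on_def intro!: linearI)
  finally show ?thesis .
qed

lemma dim_adjoin_columns_insert:
  fixes r :: "'i \<Rightarrow> 'a::euclidean_space"
  assumes k: "k \<notin> K" and relation: "(\<Sum>i\<in>I. \<omega> i *\<^sub>R adjoin_columns r K G i) = 0"
    and g: "(\<Sum>i\<in>I. \<omega> i * g i) \<noteq> 0"
  shows "dim (adjoin_columns r (insert k K) (G(k := g)) ` I) = dim (adjoin_columns r K G ` I) + 1"
proof -
  define a where "a = ((0, axis k 1) :: 'a \<times> (real ^ 'b))"
  have "span (adjoin_columns r K G ` I) \<subseteq> {y. snd y $ k = 0}"
    by (rule span_minimal) (use k in \<open>auto simp: adjoin_columns_def subspace_def\<close>)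
  then have "a \<notin> span (adjoin_columns r K G ` I)"
    by (auto simp: a_def)
  with relation g have
    "dim ((\<lambda>i. adjoin_columns r K G i + g i *\<^sub>R a) ` I) = dim (adjoin_columns r K G ` I) + 1"
    by (rule dim_add_column)
  moreover have "adjoin_columns r (insert k K) (G(k := g))
      = (\<lambda>i. adjoin_columns r K G i + g i *\<^sub>R a)"
    using k by (auto simp: adjoin_columns_def a_def fun_eq_iff vec_eq_iff axis_def)
  ultimately show ?thesis
    by (simp only:)
qed

lemma dim_adjoin_columns_attained:
  fixes r :: "'i \<Rightarrow> 'a::euclidean_space" and K :: "'k::finite set" and F :: "('i \<Rightarrow> real) set"
  assumes fin: "finite I"
    and separating: "\<And>\<omega>. (\<And>g. g \<in> F \<Longrightarrow> (\<Sum>i\<in>I. \<omega> i * g i) = 0) \<Longrightarrow> \<forall>i\<in>I. \<omega> i = 0"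
    and "dim (r ` I) + card K \<le> card I"
  obtains G where "G ` K \<subseteq> F" "dim (adjoin_columns r K G ` I) = dim (r ` I) + card K"
proof -
  have "\<exists>G. G ` K \<subseteq> F \<and> dim (adjoin_columns r K G ` I) = dim (r ` I) + card K"
    using finite_class.finite[of K] assms(3)
  proof induction
    case (insert k K)
    then obtain G where G: "G ` K \<subseteq> F" "dim (adjoin_columns r K G ` I) = dim (r ` I) + card K"
      by auto
    then have "\<not> indep_family I (adjoin_columns r K G)"
      using insert dim_indep_family[of I "adjoin_columns r K G"] by auto
    then obtain \<omega> where \<omega>: "(\<Sum>i\<in>I. \<omega> i *\<^sub>R adjoin_columns r K G i) = 0" "\<not> (\<forall>i\<in>I. \<omega> i = 0)"
      using indep_familyI[OF fin, of "adjoin_columns r K G"] by blast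
    then obtain g where g: "g \<in> F" "(\<Sum>i\<in>I. \<omega> i * g i) \<noteq> 0"
      using separating[of \<omega>] by blast
    have "dim (adjoin_columns r (insert k K) (G(k := g)) ` I) = dim (adjoin_columns r K G ` I) + 1"
      using insert(2) \<omega>(1) g(2) by (rule dim_adjoin_columns_insert)
    also have "\<dots> = dim (r ` I) + card (insert k K)"
      using G(2) insert(1,2) by simp
    finally have "dim (adjoin_columns r (insert k K) (G(k := g)) ` I)
        = dim (r ` I) + card (insert k K)" .
    moreover have "(G(k := g)) ` insert k K \<subseteq> F"
      using G(1) g(1) by auto
    ultimately show ?case
      by (intro exI[of _ "G(k := g)"] conjI)
  qed (simp add: dim_adjoin_columns_empty)
  then show thesis
    using that by blast
qed

section \<open>Families of functions of constant rank\<close>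

lemma local_inverse_of_tangent_to_id:
  fixes h :: "'a::euclidean_space \<Rightarrow> 'a" and h' :: "'a \<Rightarrow> 'a \<Rightarrow>\<^sub>L 'a"
  assumes "open U" "p \<in> U"
    and "\<And>q. q \<in> U \<Longrightarrow> (h has_derivative blinfun_apply (h' q)) (at q)" "continuous_on U h'"
    and hp: "h p = p" and h'p: "h' p = id_blinfun"
  obtains g r where "r > 0" "open (g ` ball p r)" "g ` ball p r \<subseteq> U" "g p = p"
    "(g has_derivative (\<lambda>u. u)) (at p)" "\<And>y. y \<in> ball p r \<Longrightarrow> g differentiable (at y)"
    "\<And>y. y \<in> ball p r \<Longrightarrow> h (g y) = y"
proof -
  obtain U' V g g' where U': "open U'" "U' \<subseteq> U" "p \<in> U'" and V: "open V" "p \<in> V"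
    and hom: "homeomorphism U' V h g"
    and g': "\<And>y. y \<in> V \<Longrightarrow> (g has_derivative g' y) (at y)"
      "\<And>y. y \<in> V \<Longrightarrow> g' y = inv (blinfun_apply (h' (g y)))"
  proof (rule inverse_function_theorem[OF assms(1,3,4,2)])
    show "id_blinfun o\<^sub>L h' p = id_blinfun"
      by (simp add: h'p blinfun_eqI)
  qed (use hp in auto)
  obtain r where r: "r > 0" "ball p r \<subseteq> V"
    using V openE by blast
  have gp: "g p = p"
    using homeomorphism_apply1[OF hom U'(3)] hp by simp
  have image: "g ` ball p r = U' \<inter> h -` ball p r"
    using hom r(2) unfolding homeomorphism_def by (auto 0 3 simp: image_iff)
  show thesis
  proof
    show "open (g ` ball p r)"
      using image hom U'(1) by (simp add: homeomorphism_def continuous_open_preimage)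
    show "g ` ball p r \<subseteq> U"
      using image U'(2) by auto
    show "(g has_derivative (\<lambda>u. u)) (at p)"
      using g'[OF V(2)] by (simp add: gp h'p inv_id[unfolded id_def])
    show "g differentiable (at y)" if "y \<in> ball p r" for y
      using g'(1) that r(2) unfolding differentiable_def by blast
    show "h (g y) = y" if "y \<in> ball p r" for y
      using that r(2) homeomorphism_apply2[OF hom] by blast
  qed (use r(1) gp in simp_all)
qed

locale constant_rank_family =
  fixes f :: "'i \<Rightarrow> 'a::euclidean_space \<Rightarrow> real" and grad :: "'i \<Rightarrow> 'a \<Rightarrow> 'a"
    and J K :: "'i set" and U :: "'a set" and p :: 'a
  assumes J_subset_K: "J \<subseteq> K" and open_U: "open U" and p_in_U: "p \<in> U"
    and has_derivative_grad:
      "\<And>e q. e \<in> K \<Longrightarrow> q \<in> U \<Longrightarrow> (f e has_derivative (\<lambda>u. grad e q \<bullet> u)) (at q)"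
    and continuous_on_grad: "\<And>e. e \<in> J \<Longrightarrow> continuous_on U (grad e)"
    and indep_grad: "indep_family J (\<lambda>e. grad e p)"
    and grad_in_span: "\<And>e q. e \<in> K \<Longrightarrow> q \<in> U \<Longrightarrow> grad e q \<in> span ((\<lambda>e. grad e q) ` J)"
begin

definition straightens :: "('a \<Rightarrow> 'a) \<Rightarrow> real \<Rightarrow> bool" where
  "straightens g r \<longleftrightarrow>
     r > 0 \<and> open (g ` ball p r) \<and> g ` ball p r \<subseteq> U \<and> g p = p \<and>
     (g has_derivative (\<lambda>u. u)) (at p) \<and> (\<forall>y\<in>ball p r. g differentiable (at y)) \<and>
     (\<forall>y\<in>ball p r. \<forall>e\<in>J. f e (g y) = f e p + grad e p \<bullet> (y - p))"

text \<open>
  With \<open>w\<close> dual to the gradients at \<open>p\<close>, the map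
  \<open>q \<mapsto> q + (\<Sum>e\<in>J. (f e q - f e p - grad e p \<bullet> (q - p)) *\<^sub>R w e)\<close> agrees with the identity to first
  order at \<open>p\<close>, and its inverse makes each \<open>f e\<close> with \<open>e \<in> J\<close> affine.
\<close>

lemma straightening_exists:
  obtains g r where "straightens g r"
proof -
  obtain w where w: "\<And>d e. d \<in> J \<Longrightarrow> e \<in> J \<Longrightarrow> grad d p \<bullet> w e = (if d = e then 1 else 0)"
    using indep_family_dual[OF indep_grad] by blast
  have finite_J: "finite J"
    using indep_grad by (auto simp: indep_family_def dest: independent_imp_finite finite_imageD)
  define h where "h q = q + (\<Sum>e\<in>J. (f e q - f e p - grad e p \<bullet> (q - p)) *\<^sub>R w e)" for q
  define h' where
    "h' q = id_blinfun +
      (\<Sum>e\<in>J. blinfun_scaleR_left (w e) o\<^sub>L blinfun_inner_right (grad e q - grad e p))" for q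
  have "(h has_derivative blinfun_apply (h' q)) (at q)" if "q \<in> U" for q
  proof -
    have "(h has_derivative (\<lambda>u. u + (\<Sum>e\<in>J. (grad e q \<bullet> u - grad e p \<bullet> u) *\<^sub>R w e))) (at q)"
      unfolding h_def using J_subset_K that
      by (auto intro!: derivative_eq_intros has_derivative_grad)
    moreover have "blinfun_apply (h' q) u = u + (\<Sum>e\<in>J. (grad e q \<bullet> u - grad e p \<bullet> u) *\<^sub>R w e)" for u
      by (simp add: h'_def plus_blinfun.rep_eq blinfun.sum_left inner_diff_left)
    ultimately show ?thesis by presburger
  qed
  moreover have "continuous_on U h'"
    unfolding h'_def by (auto intro!: continuous_intros continuous_on_grad)
  moreover have "h p = p" "h' p = id_blinfun"
    by (simp_all add: h'_def h_def blinfun_eqI blinfun.sum_left plus_blinfun.rep_eq)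
  ultimately obtain g r where g: "r > 0" "open (g ` ball p r)" "g ` ball p r \<subseteq> U" "g p = p"
      "(g has_derivative (\<lambda>u. u)) (at p)" "\<And>y. y \<in> ball p r \<Longrightarrow> g differentiable (at y)"
    and hg: "\<And>y. y \<in> ball p r \<Longrightarrow> h (g y) = y"
    using local_inverse_of_tangent_to_id[OF open_U p_in_U, of h h'] by metis
  have inner_h: "grad e p \<bullet> (h q - q) = f e q - f e p - grad e p \<bullet> (q - p)" if "e \<in> J" for e q
    using that finite_J
    by (simp add: h_def inner_sum_right w if_distrib[of "(*) _"] cong: if_cong sum.cong)
  have "f e (g y) = f e p + grad e p \<bullet> (y - p)" if "y \<in> ball p r" "e \<in> J" for y e
    using inner_h[OF that(2), of "g y"] hg[OF that(1)] by (simp add: inner_diff_right)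
  then show thesis
    using that[of g r] g unfolding straightens_def by blast
qed

lemma grad_straightened:
  assumes g: "straightens g r" and y: "y \<in> ball p r"
    and g': "(g has_derivative g') (at y)" and e: "e \<in> J"
  shows "grad e (g y) \<bullet> g' u = grad e p \<bullet> u"
proof -
  have "g y \<in> U"
    using g y by (auto simp: straightens_def)
  then have "((\<lambda>y. f e (g y)) has_derivative (\<lambda>u. grad e (g y) \<bullet> g' u)) (at y)"
    using has_derivative_compose[OF g' has_derivative_grad[of e]] J_subset_K e by blast
  moreover have "((\<lambda>y. f e (g y)) has_derivative (\<lambda>u. grad e p \<bullet> u)) (at y)"
  proof (rule has_derivative_transform_within_open[OF _ open_ball y])
    show "((\<lambda>y. f e p + grad e p \<bullet> (y - p)) has_derivative (\<lambda>u. grad e p \<bullet> u)) (at y)"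
      by (auto intro!: derivative_eq_intros)
  qed (use g e in \<open>simp add: straightens_def\<close>)
  ultimately have "(\<lambda>u. grad e (g y) \<bullet> g' u) = (\<lambda>u. grad e p \<bullet> u)"
    by (rule has_derivative_unique)
  then show ?thesis
    by (rule fun_cong)
qed

lemma grad_straightened_eq_0:
  assumes g: "straightens g r" and y: "y \<in> ball p r" and g': "(g has_derivative g') (at y)"
    and u: "\<And>e. e \<in> J \<Longrightarrow> grad e p \<bullet> u = 0" and e: "e \<in> K"
  shows "grad e (g y) \<bullet> g' u = 0"
proof -
  have "g y \<in> U"
    using g y by (auto simp: straightens_def)
  then have "orthogonal (g' u) (grad e (g y))"
    by (rule orthogonal_to_span[OF grad_in_span[OF e]])
      (use grad_straightened[OF g y g'] u in \<open>auto simp: orthogonal_def inner_commute\<close>)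
  then show ?thesis
    by (simp add: orthogonal_def inner_commute)
qed

lemma straightened_const:
  assumes g: "straightens g r" and y: "y \<in> ball p r"
    and slice: "\<And>e. e \<in> J \<Longrightarrow> grad e p \<bullet> (y - p) = 0" and e: "e \<in> K"
  shows "f e (g y) = f e p"
proof -
  define z where "z t = p + t *\<^sub>R (y - p)" for t
  have z_ball: "z t \<in> ball p r" if "t \<in> {0..1}" for t
  proof -
    have "p \<in> ball p r"
      using g by (simp add: straightens_def)
    then have "(1 - t) *\<^sub>R p + t *\<^sub>R y \<in> ball p r"
      using that y by (intro convexD[OF convex_ball]) auto
    then show ?thesis by (simp add: z_def algebra_simps)
  qed
  have "((\<lambda>t. f e (g (z t))) has_derivative (\<lambda>s. 0)) (at t within {0..1})" if t: "t \<in> {0..1}" for t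
  proof -
    obtain g' where g': "(g has_derivative g') (at (z t))"
      using g z_ball[OF t] unfolding straightens_def differentiable_def by blast
    have gz: "g (z t) \<in> U"
      using g z_ball[OF t] by (auto simp: straightens_def)
    have "grad e (g (z t)) \<bullet> g' (y - p) = 0"
      by (rule grad_straightened_eq_0[OF g z_ball[OF t] g' slice e])
    moreover have "(z has_derivative (\<lambda>s. s *\<^sub>R (y - p))) (at t)"
      unfolding z_def by (auto intro!: derivative_eq_intros)
    then have "((\<lambda>t. g (z t)) has_derivative (\<lambda>s. g' (s *\<^sub>R (y - p)))) (at t)"
      using g' by (rule has_derivative_compose)
    then have "((\<lambda>t. f e (g (z t))) has_derivative
        (\<lambda>s. grad e (g (z t)) \<bullet> g' (s *\<^sub>R (y - p)))) (at t)"
      using has_derivative_grad[OF e gz] by (rule has_derivative_compose)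
    moreover have "g' (s *\<^sub>R (y - p)) = s *\<^sub>R g' (y - p)" for s
      using g' has_derivative_linear linear_cmul by blast
    ultimately show ?thesis
      by (simp add: has_derivative_at_withinI)
  qed
  from has_derivative_zero_unique[OF convex_real_interval(5) this, of 1 0]
  show ?thesis
    using g by (simp add: z_def straightens_def)
qed

lemma eventually_level_set_subset:
  "\<forall>\<^sub>F q in nhds p. (\<forall>e\<in>J. f e q = f e p) \<longrightarrow> (\<forall>e\<in>K. f e q = f e p)"
proof -
  obtain g r where g: "straightens g r"
    by (rule straightening_exists)
  then have "g p \<in> g ` ball p r"
    by (intro imageI) (simp add: straightens_def)
  then have "\<forall>\<^sub>F q in nhds p. q \<in> g ` ball p r"
    using g by (intro eventually_nhds_in_open) (auto simp: straightens_def)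
  then show ?thesis
  proof (rule eventually_mono, intro impI ballI)
    fix q e assume "q \<in> g ` ball p r" and J: "\<forall>e\<in>J. f e q = f e p" and e: "e \<in> K"
    then obtain y where y: "y \<in> ball p r" "q = g y" by blast
    then have "grad e p \<bullet> (y - p) = 0" if "e \<in> J" for e
      using g J that by (fastforce simp: straightens_def)
    then show "f e q = f e p"
      using straightened_const[OF g y(1) _ e] y(2) by blast
  qed
qed

lemma level_set_curve:
  assumes u: "\<And>e. e \<in> J \<Longrightarrow> grad e p \<bullet> u = 0"
  obtains \<gamma> where "\<gamma> 0 = p" "(\<gamma> has_vector_derivative u) (at 0)"
    "\<forall>\<^sub>F t in at 0. \<forall>e\<in>K. f e (\<gamma> t) = f e p"
proof -
  obtain g r where g: "straightens g r"
    by (rule straightening_exists)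
  define \<gamma> where "\<gamma> t = g (p + t *\<^sub>R u)" for t
  have "((\<lambda>t. p + t *\<^sub>R u) has_derivative (\<lambda>t. t *\<^sub>R u)) (at 0)"
    by (auto intro!: derivative_eq_intros)
  then have "(\<gamma> has_vector_derivative u) (at 0)"
    unfolding \<gamma>_def has_vector_derivative_def
    by (rule has_derivative_compose) (use g in \<open>simp add: straightens_def\<close>)
  moreover have "\<forall>\<^sub>F t in at 0. p + t *\<^sub>R u \<in> ball p r"
    by (rule topological_tendstoD[where l = p])
      (use g in \<open>auto intro!: tendsto_eq_intros simp: straightens_def\<close>)
  then have "\<forall>\<^sub>F t in at 0. \<forall>e\<in>K. f e (\<gamma> t) = f e p"
    by (rule eventually_mono) (auto simp: \<gamma>_def u intro!: straightened_const[OF g])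
  moreover have "\<gamma> 0 = p"
    using g by (simp add: \<gamma>_def straightens_def)
  ultimately show thesis
    using that by blast
qed

end

section \<open>Algebraic independence over the rationals\<close>

definition rat_poly_eval :: "(('i::finite \<Rightarrow> nat) \<Rightarrow> rat) \<Rightarrow> ('i \<Rightarrow> real) \<Rightarrow> real" where
  "rat_poly_eval c x = (\<Sum>a | c a \<noteq> 0. of_rat (c a) * (\<Prod>i\<in>UNIV. x i ^ a i))"

definition rat_poly_fun :: "(('i::finite \<Rightarrow> real) \<Rightarrow> real) \<Rightarrow> bool" where
  "rat_poly_fun f \<longleftrightarrow> (\<exists>c. finite {a. c a \<noteq> 0} \<and> f = rat_poly_eval c)"

lemma rat_poly_eval_superset:
  assumes "finite A" "{a. c a \<noteq> 0} \<subseteq> A"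
  shows "rat_poly_eval c x = (\<Sum>a\<in>A. of_rat (c a) * (\<Prod>i\<in>UNIV. x i ^ a i))"
  unfolding rat_poly_eval_def by (rule sum.mono_neutral_left) (use assms in auto)

lemma rat_poly_fun_add:
  assumes "rat_poly_fun f" "rat_poly_fun g"
  shows "rat_poly_fun (\<lambda>x. f x + g x)"
proof -
  obtain c d where c: "finite {a. c a \<noteq> 0}" "f = rat_poly_eval c"
    and d: "finite {a. d a \<noteq> 0}" "g = rat_poly_eval d"
    using assms unfolding rat_poly_fun_def by auto
  let ?A = "{a. c a \<noteq> 0} \<union> {a. d a \<noteq> 0}"
  have sub: "{a. c a + d a \<noteq> 0} \<subseteq> ?A" by auto
  have fin: "finite ?A" using c d by simp
  have "f x + g x = rat_poly_eval (\<lambda>a. c a + d a) x" for x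
    unfolding c d
    by (subst (1 2 3) rat_poly_eval_superset[OF fin])
      (auto simp: of_rat_add sum.distrib algebra_simps)
  moreover have "finite {a. c a + d a \<noteq> 0}"
    using finite_subset[OF sub fin] .
  ultimately show ?thesis
    unfolding rat_poly_fun_def by (intro exI[of _ "\<lambda>a. c a + d a"]) auto
qed

lemma rat_poly_fun_monomial: "rat_poly_fun (\<lambda>x. of_rat r * (\<Prod>i\<in>UNIV. x i ^ a i))"
proof -
  let ?c = "\<lambda>b. if b = a then r else 0"
  have "of_rat r * (\<Prod>i\<in>UNIV. x i ^ a i) = rat_poly_eval ?c x" for x
    by (subst rat_poly_eval_superset[of "{a}"]) auto
  moreover have "finite {b. ?c b \<noteq> 0}"
    by (rule finite_subset[of _ "{a}"]) auto
  ultimately show ?thesis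
    unfolding rat_poly_fun_def by (intro exI[of _ ?c]) auto
qed

lemma rat_poly_fun_const: "rat_poly_fun (\<lambda>x. of_rat r)"
  using rat_poly_fun_monomial[of r "\<lambda>_. 0"] by simp

lemma rat_poly_fun_of_int: "rat_poly_fun (\<lambda>x. of_int z)"
  using rat_poly_fun_const[of "of_int z"] by simp

lemma rat_poly_fun_var: "rat_poly_fun (\<lambda>x. x i)"
proof -
  have "(\<Prod>j\<in>UNIV. x j ^ (if j = i then 1 else 0)) = x i" for x :: "'a \<Rightarrow> real"
    by (subst prod.mono_neutral_right[of _ "{i}"]) auto
  then show ?thesis
    using rat_poly_fun_monomial[of 1 "\<lambda>j. if j = i then 1 else 0"] by simp
qed

lemma rat_poly_fun_sum:
  assumes "\<And>t. t \<in> T \<Longrightarrow> rat_poly_fun (f t)"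
  shows "rat_poly_fun (\<lambda>x. \<Sum>t\<in>T. f t x)"
proof (cases "finite T")
  case True
  then show ?thesis using assms
    by induction (auto intro: rat_poly_fun_add rat_poly_fun_of_int[of 0, simplified])
qed (use rat_poly_fun_of_int[of 0] in simp)

lemma rat_poly_fun_mult:
  assumes "rat_poly_fun f" "rat_poly_fun g"
  shows "rat_poly_fun (\<lambda>x. f x * g x)"
proof -
  obtain c d where c: "f = rat_poly_eval c" and d: "g = rat_poly_eval d"
    using assms unfolding rat_poly_fun_def by auto
  have "f x * g x = (\<Sum>a | c a \<noteq> 0. \<Sum>b | d b \<noteq> 0.
      of_rat (c a * d b) * (\<Prod>i\<in>UNIV. x i ^ (a i + b i)))" for x
    unfolding c d rat_poly_eval_def
    by (simp add: sum_product of_rat_mult power_add prod.distrib mult_ac)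
  then show ?thesis
    by (simp only:) (intro rat_poly_fun_sum rat_poly_fun_monomial)
qed

lemma rat_poly_fun_prod:
  assumes "\<And>t. t \<in> T \<Longrightarrow> rat_poly_fun (f t)"
  shows "rat_poly_fun (\<lambda>x. \<Prod>t\<in>T. f t x)"
proof (cases "finite T")
  case True
  then show ?thesis using assms
    by induction (auto intro: rat_poly_fun_mult rat_poly_fun_of_int[of 1, simplified])
qed (use rat_poly_fun_of_int[of 1] in simp)

lemma rat_poly_fun_diff:
  assumes "rat_poly_fun f" "rat_poly_fun g"
  shows "rat_poly_fun (\<lambda>x. f x - g x)"
  using rat_poly_fun_add[OF assms(1) rat_poly_fun_mult[OF rat_poly_fun_of_int[of "-1"] assms(2)]]
  by simp

lemma rat_poly_fun_det:
  assumes "\<And>i j. rat_poly_fun (\<lambda>x. M x $ i $ j)"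
  shows "rat_poly_fun (\<lambda>x. det (M x))"
  unfolding det_def
  by (intro rat_poly_fun_sum rat_poly_fun_mult rat_poly_fun_prod rat_poly_fun_of_int assms)

lemma alg_indep_rat_poly_fun_eq_0:
  assumes "alg_indep_over_rat x" "rat_poly_fun f" "f x = 0"
  shows "f y = 0"
proof -
  obtain c where c: "finite {a. c a \<noteq> 0}" "f = rat_poly_eval c"
    using assms(2) unfolding rat_poly_fun_def by auto
  then have "\<forall>a. c a = 0"
    using assms(1,3) unfolding alg_indep_over_rat_def rat_poly_eval_def by blast
  then show ?thesis by (simp add: c rat_poly_eval_def)
qed

lemma countable_finite_support:
  "countable {c :: ('i::finite \<Rightarrow> nat) \<Rightarrow> rat. finite {a. c a \<noteq> 0}}"
proof -
  let ?g = "\<lambda>c :: ('i \<Rightarrow> nat) \<Rightarrow> rat. (\<lambda>a. (a, c a)) ` {a. c a \<noteq> 0}"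
  have inj: "inj ?g"
  proof (rule injI, rule ext)
    fix c d a assume "?g c = ?g d"
    then have same_graph: "(a, y) \<in> ?g c \<longleftrightarrow> (a, y) \<in> ?g d" for y by simp
    from same_graph[of "c a"] same_graph[of "d a"] show "c a = d a" by auto
  qed
  have "countable (?g ` {c. finite {a. c a \<noteq> 0}})"
    by (rule countable_subset[OF _ countable_Collect_finite]) auto
  then show ?thesis
    using countable_image_inj_on inj inj_on_subset by blast
qed

definition var_coeff :: "'i \<Rightarrow> nat \<Rightarrow> (('i \<Rightarrow> nat) \<Rightarrow> rat) \<Rightarrow> ('i \<Rightarrow> nat) \<Rightarrow> rat" where
  "var_coeff i j c b = (if b i = 0 then c (b(i := j)) else 0)"

definition univariate_slice ::
  "'i::finite \<Rightarrow> (('i \<Rightarrow> nat) \<Rightarrow> rat) \<Rightarrow> ('i \<Rightarrow> real) \<Rightarrow> real poly" where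
  "univariate_slice i c x =
     (\<Sum>a | c a \<noteq> 0. monom (of_rat (c a) * (\<Prod>l\<in>UNIV - {i}. x l ^ a l)) (a i))"

lemma poly_univariate_slice: "poly (univariate_slice i c x) t = rat_poly_eval c (x(i := t))"
proof -
  have "(\<Prod>l\<in>UNIV. (x(i := t)) l ^ a l) = t ^ a i * (\<Prod>l\<in>UNIV - {i}. x l ^ a l)" for a
    by (subst prod.remove[of _ i]) (auto intro!: prod.cong)
  then show ?thesis
    by (simp add: univariate_slice_def rat_poly_eval_def poly_sum poly_monom mult_ac)
qed

lemma coeff_univariate_slice:
  assumes "finite {a. c a \<noteq> 0}"
  shows "coeff (univariate_slice i c x) j = rat_poly_eval (var_coeff i j c) x"
proof -
  have "coeff (univariate_slice i c x) j =
      (\<Sum>a | c a \<noteq> 0. if a i = j then of_rat (c a) * (\<Prod>l\<in>UNIV - {i}. x l ^ a l) else 0)"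
    by (auto simp: univariate_slice_def coeff_sum intro!: sum.cong)
  also have "\<dots> = (\<Sum>a | c a \<noteq> 0 \<and> a i = j. of_rat (c a) * (\<Prod>l\<in>UNIV - {i}. x l ^ a l))"
    using assms by (simp add: sum.inter_filter[symmetric])
  also have "\<dots> = rat_poly_eval (var_coeff i j c) x"
    unfolding rat_poly_eval_def
  proof (rule sum.reindex_bij_witness[of _ "\<lambda>b. b(i := j)" "\<lambda>a. a(i := 0)"])
    fix a assume "a \<in> {a. c a \<noteq> 0 \<and> a i = j}"
    moreover have "(\<Prod>l\<in>UNIV. x l ^ (a(i := 0)) l) = (\<Prod>l\<in>UNIV - {i}. x l ^ a l)"
      by (subst prod.remove[of _ i]) (auto intro!: prod.cong)
    ultimately show "of_rat (var_coeff i j c (a(i := 0))) * (\<Prod>l\<in>UNIV. x l ^ (a(i := 0)) l)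
        = of_rat (c a) * (\<Prod>l\<in>UNIV - {i}. x l ^ a l)"
      by (auto simp: var_coeff_def fun_upd_idem)
  qed (auto simp: var_coeff_def fun_upd_idem split: if_splits)
  finally show ?thesis .
qed

lemma finite_support_var_coeff:
  assumes "finite {a. c a \<noteq> 0}"
  shows "finite {b. var_coeff i j c b \<noteq> 0}"
proof (rule finite_subset)
  show "{b. var_coeff i j c b \<noteq> 0} \<subseteq> (\<lambda>a. a(i := 0)) ` {a. c a \<noteq> 0}"
  proof
    fix b assume "b \<in> {b. var_coeff i j c b \<noteq> 0}"
    then have "b = (b(i := j))(i := 0)" "c (b(i := j)) \<noteq> 0"
      by (auto simp: var_coeff_def fun_upd_idem split: if_splits)
    then show "b \<in> (\<lambda>a. a(i := 0)) ` {a. c a \<noteq> 0}"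
      by blast
  qed
qed (use assms in simp)

definition alg_indep_on :: "'i::finite set \<Rightarrow> ('i \<Rightarrow> real) \<Rightarrow> bool" where
  "alg_indep_on S x \<longleftrightarrow>
     (\<forall>c. finite {a. c a \<noteq> 0} \<longrightarrow> (\<forall>a i. c a \<noteq> 0 \<longrightarrow> i \<notin> S \<longrightarrow> a i = 0) \<longrightarrow>
        rat_poly_eval c x = 0 \<longrightarrow> (\<forall>a. c a = 0))"

lemma alg_indep_on_empty: "alg_indep_on {} x"
proof -
  have "c a = 0" if "\<forall>a i. c a \<noteq> 0 \<longrightarrow> a i = 0" "rat_poly_eval c x = 0"
    for c :: "('a \<Rightarrow> nat) \<Rightarrow> rat" and a
  proof -
    have only_const: "a = (\<lambda>_. 0)" if "c a \<noteq> 0" for a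
      using that \<open>\<forall>a i. c a \<noteq> 0 \<longrightarrow> a i = 0\<close> by blast
    then have "rat_poly_eval c x = of_rat (c (\<lambda>_. 0))"
      by (subst rat_poly_eval_superset[of "{\<lambda>_. 0}"]) auto
    then show ?thesis
      using only_const \<open>rat_poly_eval c x = 0\<close> by fastforce
  qed
  then show ?thesis
    unfolding alg_indep_on_def by blast
qed

lemma univariate_slice_nonzero:
  assumes x: "alg_indep_on S x" and c: "finite {a. c a \<noteq> 0}" "c a \<noteq> 0"
    and supp: "\<And>a l. c a \<noteq> 0 \<Longrightarrow> l \<notin> insert i S \<Longrightarrow> a l = 0"
  shows "univariate_slice i c x \<noteq> 0"
proof
  assume "univariate_slice i c x = 0"
  then have "rat_poly_eval (var_coeff i (a i) c) x = 0"
    by (simp add: coeff_univariate_slice[OF c(1), symmetric])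
  moreover have "b l = 0" if "var_coeff i (a i) c b \<noteq> 0" "l \<notin> S" for b l
    using that supp[of "b(i := a i)" l] by (auto simp: var_coeff_def split: if_splits)
  ultimately have "var_coeff i (a i) c (a(i := 0)) = 0"
    using x finite_support_var_coeff[OF c(1)] unfolding alg_indep_on_def by blast
  then show False
    using c(2) by (simp add: var_coeff_def fun_upd_idem)
qed

text \<open>
  Only countably many values of the new coordinate are roots of one of the countably many slices.
\<close>

lemma alg_indep_on_insert:
  assumes x: "alg_indep_on S x"
  obtains t where "alg_indep_on (insert i S) (x(i := t))"
proof -
  define C where "C = {c :: ('a \<Rightarrow> nat) \<Rightarrow> rat. finite {a. c a \<noteq> 0} \<and>
    (\<forall>a l. c a \<noteq> 0 \<longrightarrow> l \<notin> insert i S \<longrightarrow> a l = 0) \<and> (\<exists>a. c a \<noteq> 0)}"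
  have "countable C"
    by (rule countable_subset[OF _ countable_finite_support]) (auto simp: C_def)
  moreover have "univariate_slice i c x \<noteq> 0" if "c \<in> C" for c
    using that univariate_slice_nonzero[OF x] unfolding C_def by blast
  ultimately have "countable (\<Union>c\<in>C. {t. poly (univariate_slice i c x) t = 0})"
    by (auto intro!: countable_UN intro: countable_finite poly_roots_finite)
  then obtain t where "t \<notin> (\<Union>c\<in>C. {t. poly (univariate_slice i c x) t = 0})"
    using uncountable_UNIV_real by (metis UNIV_eq_I)
  then have "rat_poly_eval c (x(i := t)) \<noteq> 0" if "c \<in> C" for c
    using that by (simp add: poly_univariate_slice)
  then have "alg_indep_on (insert i S) (x(i := t))"
    unfolding alg_indep_on_def C_def by blast
  then show thesis
    by (rule that)
qed

lemma alg_indep_over_rat_exists: "\<exists>x :: 'i::finite \<Rightarrow> real. alg_indep_over_rat x"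
proof -
  have "\<exists>x :: 'i \<Rightarrow> real. alg_indep_on S x" if "finite S" for S
    using that
  proof induction
    case (insert i S)
    then show ?case
      using alg_indep_on_insert by metis
  qed (use alg_indep_on_empty in blast)
  from this[OF finite_class.finite_UNIV] show ?thesis
    unfolding alg_indep_on_def alg_indep_over_rat_def rat_poly_eval_def by auto
qed

section \<open>Independence at algebraically independent points\<close>

text \<open>
  The padding by the identity outside \<open>J\<close> makes the Gram determinant available for all subfamilies
  of one type; being a rational polynomial in the coordinates, it transfers independence from any
  point to the algebraically independent ones.
\<close>

definition gram_matrix :: "'i::finite set \<Rightarrow> ('i \<Rightarrow> 'a::real_inner) \<Rightarrow> real ^ 'i ^ 'i" where
  "gram_matrix J r = (\<chi> i j. if i \<in> J \<and> j \<in> J then r i \<bullet> r j else if i = j then 1 else 0)"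

lemma gram_matrix_mult:
  "(gram_matrix J r *v x) $ i = (if i \<in> J then r i \<bullet> (\<Sum>j\<in>J. x $ j *\<^sub>R r j) else x $ i)"
proof (cases "i \<in> J")
  case True
  then have "(gram_matrix J r *v x) $ i = (\<Sum>j\<in>UNIV. if j \<in> J then x $ j * (r i \<bullet> r j) else 0)"
    unfolding gram_matrix_def matrix_vector_mult_def by (auto intro!: sum.cong)
  then show ?thesis using True by (simp add: sum.If_cases inner_sum_right)
next
  case False
  then have "(gram_matrix J r *v x) $ i = (\<Sum>j\<in>UNIV. if i = j then x $ j else 0)"
    unfolding gram_matrix_def matrix_vector_mult_def
    by (simp add: if_distrib[of "\<lambda>s. s * _"] cong: if_cong)
  then show ?thesis using False by simp
qed

lemma gram_matrix_mult_eq_0_iff: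
  "gram_matrix J r *v x = 0 \<longleftrightarrow> (\<Sum>j\<in>J. x $ j *\<^sub>R r j) = 0 \<and> (\<forall>i. i \<notin> J \<longrightarrow> x $ i = 0)"
proof
  let ?s = "\<Sum>j\<in>J. x $ j *\<^sub>R r j"
  assume x: "gram_matrix J r *v x = 0"
  have outside: "i \<notin> J \<longrightarrow> x $ i = 0" and inside: "i \<in> J \<longrightarrow> r i \<bullet> ?s = 0" for i
    using arg_cong[OF x, of "\<lambda>y. y $ i"] by (auto simp: gram_matrix_mult split: if_splits)
  have "?s \<bullet> ?s = (\<Sum>i\<in>J. x $ i * (r i \<bullet> ?s))"
    by (subst inner_sum_left) simp
  also have "\<dots> = 0"
    using inside by (intro sum.neutral ballI) simp
  finally show "?s = 0 \<and> (\<forall>i. i \<notin> J \<longrightarrow> x $ i = 0)"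
    using outside by simp
qed (simp add: vec_eq_iff gram_matrix_mult)

lemma indep_family_iff_gram: "indep_family J r \<longleftrightarrow> det (gram_matrix J r) \<noteq> 0"
proof -
  have "indep_family J r \<longleftrightarrow> (\<forall>x. gram_matrix J r *v x = 0 \<longrightarrow> x = 0)"
  proof (intro iffI allI impI)
    fix x assume "indep_family J r" and x: "gram_matrix J r *v x = 0"
    then have "x $ i = 0" if "i \<in> J" for i
      using indep_familyD[of J r "($) x"] that by (simp add: gram_matrix_mult_eq_0_iff)
    moreover have "x $ i = 0" if "i \<notin> J" for i
      using x that by (simp add: gram_matrix_mult_eq_0_iff)
    ultimately show "x = 0"
      by (metis vec_eq_iff zero_index)
  next
    assume kernel: "\<forall>x. gram_matrix J r *v x = 0 \<longrightarrow> x = 0"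
    show "indep_family J r"
    proof (rule indep_familyI)
      fix c :: "'a \<Rightarrow> real" assume "(\<Sum>i\<in>J. c i *\<^sub>R r i) = 0"
      then have "(\<chi> i. if i \<in> J then c i else 0) = 0"
        using kernel by (simp add: gram_matrix_mult_eq_0_iff)
      then show "\<forall>i\<in>J. c i = 0"
        by (simp add: vec_eq_iff) metis
    qed simp
  qed
  then show ?thesis
    by (simp add: invertible_det_nz[symmetric] invertible_left_inverse matrix_left_invertible_ker)
qed

lemma open_indep_family:
  fixes r :: "'b::topological_space \<Rightarrow> 'i::finite \<Rightarrow> 'a::real_inner"
  assumes "\<And>i. i \<in> J \<Longrightarrow> continuous_on UNIV (\<lambda>x. r x i)"
  shows "open {x. indep_family J (r x)}"
proof -
  have "continuous_on UNIV (\<lambda>x. gram_matrix J (r x) $ i $ j)" for i j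
    using assms by (cases "i \<in> J \<and> j \<in> J") (auto simp: gram_matrix_def intro!: continuous_intros)
  then have "continuous_on UNIV (\<lambda>x. det (gram_matrix J (r x)))"
    unfolding det_def
    by (intro continuous_on_sum continuous_on_mult continuous_on_prod continuous_on_const)
  then show ?thesis
    unfolding indep_family_iff_gram by (intro open_Collect_neq continuous_on_const)
qed

lemma indep_family_at_alg_indep:
  fixes r :: "real ^ 'c::finite \<Rightarrow> 'i::finite \<Rightarrow> real ^ 'n::finite"
  assumes r: "\<And>i k. rat_poly_fun (\<lambda>z. r (vec_lambda z) i $ k)"
    and x: "alg_indep_over_rat (($) x)" and y: "indep_family J (r y)"
  shows "indep_family J (r x)"
proof -
  let ?f = "\<lambda>z. det (gram_matrix J (r (vec_lambda z)))"
  have "rat_poly_fun ?f"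
  proof (rule rat_poly_fun_det)
    fix i j
    show "rat_poly_fun (\<lambda>z. gram_matrix J (r (vec_lambda z)) $ i $ j)"
    proof (cases "i \<in> J \<and> j \<in> J")
      case True
      then show ?thesis
        by (simp add: gram_matrix_def inner_vec_def rat_poly_fun_sum rat_poly_fun_mult r)
    next
      case False
      then show ?thesis
        using rat_poly_fun_of_int[of "if i = j then 1 else 0"] by (auto simp: gram_matrix_def)
    qed
  qed
  then have "?f (($) x) = 0 \<Longrightarrow> ?f (($) y) = 0"
    using alg_indep_rat_poly_fun_eq_0[OF x] by blast
  then show ?thesis
    using y by (auto simp: indep_family_iff_gram)
qed

lemma in_span_if_in_span_at_alg_indep:
  fixes r :: "real ^ 'c::finite \<Rightarrow> 'i::finite \<Rightarrow> real ^ 'n::finite"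
  assumes r: "\<And>i k. rat_poly_fun (\<lambda>z. r (vec_lambda z) i $ k)"
    and x: "alg_indep_over_rat (($) x)" and y: "indep_family J (r y)"
    and e: "r x e \<in> span (r x ` J)"
  shows "r y e \<in> span (r y ` J)"
proof (cases "e \<in> J")
  case False
  show ?thesis
  proof (rule ccontr)
    assume "r y e \<notin> span (r y ` J)"
    then have "indep_family (insert e J) (r y)"
      using False y by (simp add: indep_family_insert)
    then have "indep_family (insert e J) (r x)"
      by (rule indep_family_at_alg_indep[of r x, OF r x])
    then show False
      using False e by (simp add: indep_family_insert)
  qed
qed (simp add: span_base)

lemma dim_le_dim_at_alg_indep:
  fixes r :: "real ^ 'c::finite \<Rightarrow> 'i::finite \<Rightarrow> real ^ 'n::finite"
  assumes r: "\<And>i k. rat_poly_fun (\<lambda>z. r (vec_lambda z) i $ k)" and x: "alg_indep_over_rat (($) x)"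
  shows "dim (r y ` I) \<le> dim (r x ` I)"
proof -
  obtain J where J: "J \<subseteq> I" "indep_family J (r y)" "r y ` I \<subseteq> span (r y ` J)"
    by (rule indep_family_spanning_subset)
  have "dim (r y ` I) \<le> dim (r y ` J)"
    using dim_subset[OF J(3)] by simp
  also have "\<dots> = dim (r x ` J)"
    using indep_family_at_alg_indep[of r x, OF r x J(2)] J(2) by (simp add: dim_indep_family)
  also have "\<dots> \<le> dim (r x ` I)"
    using J(1) by (intro dim_subset image_mono)
  finally show ?thesis .
qed

section \<open>Isometries of spanning configurations\<close>

lemma span_differences_eq_UNIV_iff:
  fixes p :: "'i \<Rightarrow> 'a::euclidean_space"
  shows "span (range (\<lambda>v. p v - p b)) = UNIV \<longleftrightarrow> affine hull range p = UNIV"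
proof -
  have hull: "affine hull range p = (\<lambda>x. p b + x) ` span (range (\<lambda>v. p v - p b))"
    by (subst affine_hull_span_gen[of "p b"]) (simp_all add: hull_inc image_image)
  show ?thesis
  proof
    assume UNIV: "affine hull range p = UNIV"
    have "x \<in> span (range (\<lambda>v. p v - p b))" for x
    proof -
      have "p b + x \<in> (\<lambda>x. p b + x) ` span (range (\<lambda>v. p v - p b))"
        using hull UNIV by simp
      then show ?thesis by auto
    qed
    then show "span (range (\<lambda>v. p v - p b)) = UNIV"
      by blast
  qed (use hull in simp)
qed

lemma linear_isometry_of_equal_inner:
  fixes a y :: "'i::finite \<Rightarrow> 'a::euclidean_space"
  assumes span: "span (range a) = UNIV" and inner: "\<And>v w. y v \<bullet> y w = a v \<bullet> a w"
  obtains L where "orthogonal_transformation L" "\<And>v. L (a v) = y v"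
proof -
  have "(\<Sum>v\<in>UNIV. c v *\<^sub>R y v) = 0" if "(\<Sum>v\<in>UNIV. c v *\<^sub>R a v) = 0" for c
  proof -
    have "norm (\<Sum>v\<in>UNIV. c v *\<^sub>R y v) = norm (\<Sum>v\<in>UNIV. c v *\<^sub>R a v)"
      by (simp add: norm_eq_sqrt_inner inner_sum_left inner_sum_right inner)
    then show ?thesis using that by simp
  qed
  then obtain L where L: "linear L" "\<And>v. L (a v) = y v"
    using linear_on_spanning_family[OF span] by blast
  have "L u \<bullet> L w = u \<bullet> w" for u w
  proof (rule bilinear_eq[of "\<lambda>u w. L u \<bullet> L w" "\<lambda>u w. u \<bullet> w" UNIV "range a" UNIV "range a"])
    show "bilinear (\<lambda>u w. L u \<bullet> L w)" "bilinear (\<lambda>u w::'a. u \<bullet> w)"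
      by (auto simp: bilinear_def linear_iff linear_add[OF L(1)] linear_cmul[OF L(1)]
          inner_add_left inner_add_right)
  qed (use span inner L(2) in auto)
  then show thesis
    using that[of L] L by (simp add: orthogonal_transformation_def)
qed

lemma isometry_of_congruent:
  fixes p q :: "'i::finite \<Rightarrow> 'a::euclidean_space"
  assumes hull: "affine hull range p = UNIV"
    and congruent: "\<And>v w. dist (p v) (p w) = dist (q v) (q w)"
  obtains T where "\<And>y z. dist (T y) (T z) = dist y z" "\<And>v. q v = T (p v)"
proof -
  fix b :: 'i
  have "(q v - q b) \<bullet> (q w - q b) = (p v - p b) \<bullet> (p w - p b)" for v w
    using congruent[of v b] congruent[of w b] congruent[of v w]
    by (simp add: dot_norm_neg dist_norm)
  then obtain L where L: "orthogonal_transformation L" "\<And>v. L (p v - p b) = q v - q b"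
    using linear_isometry_of_equal_inner[of "\<lambda>v. p v - p b" "\<lambda>v. q v - q b"] hull
    by (auto simp: span_differences_eq_UNIV_iff)
  have "dist (L s) (L t) = dist s t" for s t
    using L(1) by (simp add: dist_norm orthogonal_transformation linear_diff[symmetric])
  then have "dist (q b + L (s - p b)) (q b + L (t - p b)) = dist s t" for s t
    by (simp add: dist_norm)
  moreover have "q v = q b + L (p v - p b)" for v
    by (simp add: L(2))
  ultimately show thesis
    by (rule that[of "\<lambda>s. q b + L (s - p b)"])
qed

lemma skew_linear_of_skew_inner:
  fixes a y :: "'i::finite \<Rightarrow> 'a::euclidean_space"
  assumes span: "span (range a) = UNIV" and skew: "\<And>v w. a v \<bullet> y w = - (y v \<bullet> a w)"
  obtains L where "linear L" "\<And>v. L (a v) = y v" "\<And>u w. u \<bullet> L w = - (L u \<bullet> w)"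
proof -
  have "(\<Sum>v\<in>UNIV. c v *\<^sub>R y v) = 0" (is "?s = 0") if "(\<Sum>v\<in>UNIV. c v *\<^sub>R a v) = 0" for c
  proof -
    have "?s \<bullet> a w = - ((\<Sum>v\<in>UNIV. c v *\<^sub>R a v) \<bullet> y w)" for w
      by (simp add: inner_sum_left skew sum_negf)
    then have "orthogonal ?s x" if "x \<in> range a" for x
      using \<open>(\<Sum>v\<in>UNIV. c v *\<^sub>R a v) = 0\<close> that by (auto simp: orthogonal_def)
    then have "orthogonal ?s ?s"
      using orthogonal_to_span[of ?s "range a"] span by blast
    then show ?thesis
      by (simp add: orthogonal_def)
  qed
  then obtain L where L: "linear L" "\<And>v. L (a v) = y v"
    using linear_on_spanning_family[OF span] by blast
  have "u \<bullet> L w = - (L u \<bullet> w)" for u w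
  proof (rule bilinear_eq[of "\<lambda>u w. u \<bullet> L w" "\<lambda>u w. - (L u \<bullet> w)" UNIV "range a" UNIV "range a"])
    show "bilinear (\<lambda>u w. u \<bullet> L w)" "bilinear (\<lambda>u w. - (L u \<bullet> w))"
      by (auto simp: bilinear_def linear_iff linear_add[OF L(1)] linear_cmul[OF L(1)]
          inner_add_left inner_add_right)
  qed (use span skew L(2) in auto)
  then show thesis
    using that L by blast
qed

subsection \<open>Skew-symmetric matrices\<close>

definition skew_matrices :: "(real ^ 'n ^ 'n::finite) set" where
  "skew_matrices = {A. transpose A = - A}"

lemma skew_matrices_iff_entries: "A \<in> skew_matrices \<longleftrightarrow> (\<forall>i j. A $ i $ j + A $ j $ i = 0)"
  by (simp add: skew_matrices_def transpose_def vec_eq_iff add_eq_0_iff)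

lemma skew_matrices_iff_inner:
  "A \<in> skew_matrices \<longleftrightarrow> (\<forall>u w. u \<bullet> (A *v w) = - ((A *v u) \<bullet> w))"
proof -
  have "u \<bullet> (A *v w) = (transpose A *v u) \<bullet> w" for u w
    by (simp add: dot_lmul_matrix)
  moreover have "(- A) *v u = - (A *v u)" for u
    by (simp add: matrix_vector_mult_def vec_eq_iff sum_negf)
  ultimately show ?thesis
    by (auto simp: skew_matrices_def matrix_eq vector_eq_rdot)
      (metis inner_minus_left vector_eq_rdot)
qed

lemma subspace_skew_matrices: "subspace skew_matrices"
  by (auto simp: subspace_def skew_matrices_iff_inner matrix_vector_mult_add_rdistrib
      scaleR_matrix_vector_assoc[symmetric] inner_add_left inner_add_right)

lemma card_ordered_pairs:
  fixes f :: "'n::finite \<Rightarrow> nat"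
  assumes "inj f"
  shows "card {(i, j). f i < f j} = CARD('n) choose 2"
proof -
  have "bij_betw (\<lambda>(i, j). {i, j}) {(i, j). f i < f j} {e. card e = 2}"
  proof (rule bij_betwI')
    fix e :: "'n set" assume "e \<in> {e. card e = 2}"
    then obtain i j where e: "e = {i, j}" "i \<noteq> j"
      by (auto simp: card_2_iff)
    then have "f i < f j \<or> f j < f i"
      using assms by (metis injD nat_neq_iff)
    then show "\<exists>x\<in>{(i, j). f i < f j}. e = (case x of (i, j) \<Rightarrow> {i, j})"
      using e(1) by (auto simp: insert_commute)
  qed (auto simp: doubleton_eq_iff card_2_iff)
  then have "card {(i, j). f i < f j} = card {e :: 'n set. card e = 2}"
    by (rule bij_betw_same_card)
  then show ?thesis
    using n_subsets[of "UNIV :: 'n set" 2] by simp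
qed

lemma skew_matrix_eq_0_if_upper_eq_0:
  fixes f :: "'n::finite \<Rightarrow> nat"
  assumes f: "inj f" and A: "A \<in> skew_matrices" and upper: "\<And>i j. f i < f j \<Longrightarrow> A $ i $ j = 0"
  shows "A = 0"
proof -
  have skew: "A $ i $ j + A $ j $ i = 0" for i j
    using A by (simp only: skew_matrices_iff_entries)
  have "A $ i $ j = 0" for i j
  proof (cases "f i" "f j" rule: linorder_cases)
    case equal
    then show ?thesis
      using skew[of i i] injD[OF f] by fastforce
  qed (use upper[of i j] upper[of j i] skew[of i j] in simp_all)
  then show ?thesis
    by (simp add: vec_eq_iff)
qed

lemma dim_skew_matrices:
  "dim (skew_matrices :: (real ^ 'n ^ 'n::finite) set) = CARD('n) choose 2"
proof -
  obtain f :: "'n \<Rightarrow> nat" where f: "inj f"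
    using finite_imp_inj_to_nat_seg[of "UNIV :: 'n set"] by auto
  define upper :: "real ^ 'n ^ 'n \<Rightarrow> real ^ ('n \<times> 'n)" where
    "upper A = (\<chi> c. case c of (i, j) \<Rightarrow> if f i < f j then A $ i $ j else 0)" for A
  have upper: "linear upper"
    by (rule linearI) (auto simp: upper_def vec_eq_iff)
  have "A = 0" if "A \<in> skew_matrices" "upper A = 0" for A
  proof (rule skew_matrix_eq_0_if_upper_eq_0[OF f that(1)])
    fix i j assume "f i < f j"
    then show "A $ i $ j = 0"
      using arg_cong[OF that(2), of "\<lambda>B. B $ (i, j)"] by (simp add: upper_def)
  qed
  then have "dim (upper ` skew_matrices) = dim (skew_matrices :: (real ^ 'n ^ 'n) set)"
    by (intro dim_image_eq[OF upper])
      (simp add: span_eq_iff[THEN iffD2] subspace_skew_matrices linear_inj_on_iff_eq_0[OF upper])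
  moreover have "upper ` skew_matrices = {B. \<forall>c. c \<notin> {(i, j). f i < f j} \<longrightarrow> B $ c = 0}" (is "_ = ?B")
  proof
    show "?B \<subseteq> upper ` skew_matrices"
    proof
      fix B assume B: "B \<in> ?B"
      show "B \<in> upper ` skew_matrices"
      proof (rule image_eqI)
        show "B = upper (\<chi> i j. B $ (i, j) - B $ (j, i))"
          using B by (auto simp: upper_def vec_eq_iff)
        show "(\<chi> i j. B $ (i, j) - B $ (j, i)) \<in> skew_matrices"
          by (simp add: skew_matrices_iff_entries)
      qed
    qed
  qed (auto simp: upper_def)
  moreover have "dim ?B = card {(i, j). f i < f j}"
    using dim_substandard_cart[where 'a = real, of "{(i, j). f i < f j}"] by (simp add: dim_vec_eq)
  ultimately show ?thesis
    using card_ordered_pairs[OF f] by simp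
qed

section \<open>Configurations and the rigidity matrix\<close>

abbreviation all_edges :: "'v set set" where
  "all_edges \<equiv> {e. card e = 2}"

lemma simple_graph_iff: "simple_graph E \<longleftrightarrow> E \<subseteq> all_edges"
  by (auto simp: simple_graph_def)

definition point :: "real ^ ('v::finite \<times> 'n::finite) \<Rightarrow> 'v \<Rightarrow> real ^ 'n" where
  "point x v = (\<chi> j. x $ (v, j))"

definition config :: "('v::finite \<Rightarrow> real ^ 'n::finite) \<Rightarrow> real ^ ('v \<times> 'n)" where
  "config p = (\<chi> c. p (fst c) $ snd c)"

lemma point_config [simp]: "point (config p) = p"
  by (simp add: fun_eq_iff point_def config_def vec_eq_iff)

lemma config_point [simp]: "config (point x) = x"
  by (simp add: point_def config_def vec_eq_iff)

lemma generic_point: "generic (point x) \<longleftrightarrow> alg_indep_over_rat (($) x)"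
proof -
  have "(\<lambda>(v, i). point x v $ i) = ($) x"
    by (auto simp: point_def)
  then show ?thesis by (simp add: generic_def)
qed

lemma generic_exists: "\<exists>x :: real ^ ('v::finite \<times> 'n::finite). generic (point x)"
proof -
  obtain z :: "'v \<times> 'n \<Rightarrow> real" where "alg_indep_over_rat z"
    using alg_indep_over_rat_exists by blast
  then have "alg_indep_over_rat (($) (vec_lambda z))"
    by (simp add: vec_lambda_inverse)
  then show ?thesis
    unfolding generic_point by blast
qed

lemma dist_point_le: "dist (point x v) (point y v) \<le> dist x y"
proof -
  have "(\<Sum>j\<in>UNIV. (dist (x $ (v, j)) (y $ (v, j)))\<^sup>2)
      = (\<Sum>c\<in>Pair v ` UNIV. (dist (x $ c) (y $ c))\<^sup>2)"
    by (subst sum.reindex) (auto simp: inj_on_def)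
  also have "\<dots> \<le> (\<Sum>c\<in>UNIV. (dist (x $ c) (y $ c))\<^sup>2)"
    by (rule sum_mono2) auto
  finally show ?thesis
    by (simp add: dist_vec_def L2_set_def point_def)
qed

lemma dist_config_le:
  fixes p q :: "'v::finite \<Rightarrow> real ^ 'n::finite"
  assumes "\<And>v. dist (p v) (q v) \<le> \<delta>"
  shows "dist (config p) (config q) \<le> of_nat (CARD('v) * CARD('n)) * \<delta>"
proof -
  have "dist (config p) (config q) \<le> (\<Sum>c\<in>UNIV. \<bar>(config p - config q) $ c\<bar>)"
    unfolding dist_norm by (rule norm_le_l1_cart)
  also have "\<dots> \<le> (\<Sum>c\<in>(UNIV :: ('v \<times> 'n) set). \<delta>)"
  proof (rule sum_mono)
    fix c :: "'v \<times> 'n"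
    have "\<bar>(config p - config q) $ c\<bar> \<le> dist (p (fst c)) (q (fst c))"
      using component_le_norm_cart[of "p (fst c) - q (fst c)" "snd c"]
      by (simp add: config_def dist_norm)
    also have "\<dots> \<le> \<delta>" by (rule assms)
    finally show "\<bar>(config p - config q) $ c\<bar> \<le> \<delta>" .
  qed
  finally show ?thesis by simp
qed

lemma generic_affinely_spanning:
  fixes x :: "real ^ ('v::finite \<times> 'n::finite)"
  assumes gen: "generic (point x)" and card: "CARD('n) < CARD('v)"
  shows "affine hull range (point x) = UNIV"
proof -
  fix b :: 'v
  have "CARD('n) \<le> card (UNIV - {b})"
    using card by (simp add: card_Diff_singleton)
  then obtain f :: "'n \<Rightarrow> 'v" where f: "range f \<subseteq> UNIV - {b}" "inj f"
    using card_le_inj[of "UNIV :: 'n set" "UNIV - {b}"] by auto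
  let ?M = "\<lambda>z. \<chi> i j. z (f i, j) - z (b, j) :: real ^ 'n ^ 'n"
  have "rat_poly_fun (\<lambda>z. det (?M z))"
    by (rule rat_poly_fun_det) (auto intro!: rat_poly_fun_diff rat_poly_fun_var)
  moreover have "?M (\<lambda>(v, j). if v = f j then 1 else 0) = mat 1"
    using f by (auto simp: mat_def vec_eq_iff inj_def)
  then have "det (?M (\<lambda>(v, j). if v = f j then 1 else 0)) \<noteq> 0"
    by simp
  ultimately have "det (?M (($) x)) \<noteq> 0"
    using alg_indep_rat_poly_fun_eq_0[OF gen[unfolded generic_point]] by blast
  then have "span (rows (?M (($) x))) = UNIV"
    by (simp add: invertible_det_nz[symmetric] invertible_left_inverse
        matrix_left_invertible_span_rows)
  moreover have "rows (?M (($) x)) \<subseteq> range (\<lambda>v. point x v - point x b)"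
    by (auto simp: rows_def row_def point_def vec_eq_iff image_iff)
  ultimately have "span (range (\<lambda>v. point x v - point x b)) = UNIV"
    using span_mono by blast
  then show ?thesis
    by (simp add: span_differences_eq_UNIV_iff)
qed

subsection \<open>The bilinear form of an edge\<close>

definition edge_inner :: "('v \<Rightarrow> 'a::real_inner) \<Rightarrow> ('v \<Rightarrow> 'a) \<Rightarrow> 'v set \<Rightarrow> real" where
  "edge_inner f g e = (\<Sum>u\<in>e. \<Sum>w\<in>e. (f u - f w) \<bullet> g u)"

lemma edge_inner_pair: "v \<noteq> w \<Longrightarrow> edge_inner f g {v, w} = (f v - f w) \<bullet> (g v - g w)"
  by (simp add: edge_inner_def inner_diff_left inner_diff_right)

lemma edge_inner_commute: "edge_inner f g e = edge_inner g f e"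
proof -
  have "edge_inner f g e = card e * (\<Sum>u\<in>e. f u \<bullet> g u) - (\<Sum>u\<in>e. f u) \<bullet> (\<Sum>u\<in>e. g u)"
    for f g :: "'a \<Rightarrow> 'b"
    by (simp add: edge_inner_def inner_sum_left inner_sum_right inner_diff_left sum_subtractf
        sum_distrib_left)
  then show ?thesis
    by (simp add: inner_commute)
qed

lemma edge_inner_shift: "edge_inner (\<lambda>v. f v + c) (\<lambda>v. g v + d) e = edge_inner f g e"
proof -
  have "edge_inner (\<lambda>v. f v + c) g e = edge_inner f g e" for f g :: "'a \<Rightarrow> 'b" and c
    by (simp add: edge_inner_def)
  then show ?thesis
    by (metis edge_inner_commute)
qed

lemma edge_inner_vec:
  fixes f g :: "'v \<Rightarrow> real ^ 'n::finite"
  shows "edge_inner f g e = (\<Sum>i\<in>UNIV. edge_inner (\<lambda>v. f v $ i) (\<lambda>v. g v $ i) e)"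
  by (simp add: edge_inner_def inner_vec_def sum.swap[of _ "UNIV :: 'n set"])

definition rigidity_row :: "real ^ ('v::finite \<times> 'n::finite) \<Rightarrow> 'v set \<Rightarrow> real ^ ('v \<times> 'n)" where
  "rigidity_row x e =
     (\<chi> c. case c of (u, j) \<Rightarrow> if u \<in> e then \<Sum>w\<in>e. x $ (u, j) - x $ (w, j) else 0)"

lemma inner_rigidity_row: "rigidity_row x e \<bullet> y = edge_inner (point x) (point y) e"
proof -
  have "rigidity_row x e \<bullet> y = (\<Sum>u\<in>UNIV. \<Sum>j\<in>UNIV. rigidity_row x e $ (u, j) * y $ (u, j))"
    unfolding inner_vec_def UNIV_Times_UNIV[symmetric] sum.cartesian_product
    by (simp add: case_prod_beta)
  also have "\<dots> = (\<Sum>u\<in>UNIV. if u \<in> e then \<Sum>w\<in>e. (point x u - point x w) \<bullet> point y u else 0)"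
  proof (rule sum.cong)
    fix u
    have "(\<Sum>j\<in>UNIV. (\<Sum>w\<in>e. x $ (u, j) - x $ (w, j)) * y $ (u, j))
      = (\<Sum>w\<in>e. (point x u - point x w) \<bullet> point y u)"
      unfolding sum_distrib_right by (subst sum.swap) (simp add: inner_vec_def point_def)
    then show "(\<Sum>j\<in>UNIV. rigidity_row x e $ (u, j) * y $ (u, j))
      = (if u \<in> e then \<Sum>w\<in>e. (point x u - point x w) \<bullet> point y u else 0)"
      by (auto simp: rigidity_row_def)
  qed simp
  finally show ?thesis
    by (simp add: edge_inner_def sum.If_cases)
qed

lemma bounded_linear_rigidity_row: "bounded_linear (\<lambda>x. rigidity_row x e)"
  unfolding linear_conv_bounded_linear[symmetric]
  by (rule linearI)
    (auto simp: rigidity_row_def vec_eq_iff sum.distrib[symmetric] sum_distrib_left algebra_simps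
      intro!: sum.cong)

lemma rat_poly_fun_rigidity_row: "rat_poly_fun (\<lambda>z. rigidity_row (vec_lambda z) e $ c)"
proof (cases c)
  case (Pair u j)
  then show ?thesis
    by (cases "u \<in> e")
      (auto simp: rigidity_row_def rat_poly_fun_of_int[of 0, simplified]
        intro!: rat_poly_fun_sum rat_poly_fun_diff rat_poly_fun_var)
qed

definition rigidity_rank :: "'v::finite set set \<Rightarrow> real ^ ('v \<times> 'n::finite) \<Rightarrow> nat" where
  "rigidity_rank E x = dim (rigidity_row x ` E)"

lemma rigidity_rank_mono: "E \<subseteq> F \<Longrightarrow> rigidity_rank E x \<le> rigidity_rank F x"
  unfolding rigidity_rank_def by (intro dim_subset image_mono)

lemma rigidity_rank_le_generic:
  fixes x y :: "real ^ ('v::finite \<times> 'n::finite)"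
  assumes "generic (point x)"
  shows "rigidity_rank E y \<le> rigidity_rank E x"
  using assms
  unfolding rigidity_rank_def generic_point
  by (rule dim_le_dim_at_alg_indep[where r = rigidity_row, OF rat_poly_fun_rigidity_row])

subsection \<open>Infinitesimal isometries\<close>

lemma infinitesimal_isometry_iff:
  "z \<in> (rigidity_row x ` all_edges)\<^sup>\<bottom> \<longleftrightarrow>
     (\<forall>v w. (point x v - point x w) \<bullet> (point z v - point z w) = 0)"
proof -
  have "z \<in> (rigidity_row x ` all_edges)\<^sup>\<bottom> \<longleftrightarrow> (\<forall>v w. v \<noteq> w \<longrightarrow> rigidity_row x {v, w} \<bullet> z = 0)"
    by (auto simp: orthogonal_comp_def orthogonal_def card_2_iff)
  then show ?thesis
    by (auto simp: inner_rigidity_row edge_inner_pair) (metis diff_self inner_zero_left)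
qed

definition affine_motion ::
  "real ^ ('v::finite \<times> 'n::finite) \<Rightarrow> (real ^ 'n ^ 'n) \<times> (real ^ 'n) \<Rightarrow> real ^ ('v \<times> 'n)" where
  "affine_motion x = (\<lambda>(A, t). config (\<lambda>v. A *v point x v + t))"

lemma linear_affine_motion: "linear (affine_motion x)"
  by (rule linearI) (auto simp: affine_motion_def config_def vec_eq_iff
      matrix_vector_mult_add_rdistrib scaleR_matrix_vector_assoc[symmetric] algebra_simps)

lemma inj_affine_motion:
  fixes x :: "real ^ ('v::finite \<times> 'n::finite)"
  assumes hull: "affine hull range (point x) = UNIV"
  shows "inj (affine_motion x)"
proof -
  fix b :: 'v
  have "A = 0 \<and> t = 0" if "affine_motion x (A, t) = 0" for A t
  proof -
    have "point (affine_motion x (A, t)) v = 0" for v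
      using that by (simp add: point_def vec_eq_iff)
    then have at: "A *v point x v + t = 0" for v
      by (simp add: affine_motion_def)
    have zero: "A *v (point x v - point x b) = 0" for v
      using at[of v] at[of b]
      by (simp add: matrix_vector_mult_diff_distrib eq_neg_iff_add_eq_0[symmetric])
    have "A *v y = 0" for y
      by (rule linear_eq_0_on_span[of "(*v) A" "range (\<lambda>v. point x v - point x b)"])
        (auto simp: zero span_differences_eq_UNIV_iff[THEN iffD2, OF hull])
    then have "A = 0"
      by (simp add: matrix_eq)
    then show ?thesis
      using at[of b] by simp
  qed
  then show ?thesis
    by (auto simp: linear_injective_0[OF linear_affine_motion] zero_prod_def)
qed

lemma infinitesimal_isometries_eq:
  fixes x :: "real ^ ('v::finite \<times> 'n::finite)"
  assumes "affine hull range (point x) = UNIV"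
  shows "(rigidity_row x ` all_edges)\<^sup>\<bottom> = affine_motion x ` (skew_matrices \<times> UNIV)"
proof safe
  fix z assume z: "z \<in> (rigidity_row x ` all_edges)\<^sup>\<bottom>"
  fix b :: 'v
  have edge: "(point x v - point x w) \<bullet> (point z v - point z w) = 0" for v w
    using z by (simp add: infinitesimal_isometry_iff)
  have "(point x v - point x b) \<bullet> (point z w - point z b)
      = - ((point z v - point z b) \<bullet> (point x w - point x b))" for v w
    using edge[of v w] edge[of v b] edge[of w b]
    by (simp add: inner_diff_left inner_diff_right inner_commute)
  then obtain L where L: "linear L" "\<And>v. L (point x v - point x b) = point z v - point z b"
      "\<And>u w. u \<bullet> L w = - (L u \<bullet> w)"
    using skew_linear_of_skew_inner[of "\<lambda>v. point x v - point x b"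
        "\<lambda>v. point z v - point z b"] assms
    by (auto simp: span_differences_eq_UNIV_iff)
  have "matrix L \<in> skew_matrices"
    using L(1,3) by (simp add: skew_matrices_iff_inner matrix_works)
  moreover have "z = affine_motion x (matrix L, point z b - matrix L *v point x b)"
  proof -
    have "matrix L *v point x v + (point z b - matrix L *v point x b) = point z v" for v
      using L(2)[of v] L(1) by (simp add: matrix_works linear_diff algebra_simps)
    then show ?thesis
      by (simp add: affine_motion_def)
  qed
  ultimately show "z \<in> affine_motion x ` (skew_matrices \<times> UNIV)"
    by (intro image_eqI[of _ _ "(matrix L, point z b - matrix L *v point x b)"]) auto
next
  fix A :: "real ^ 'n ^ 'n" and t assume "A \<in> skew_matrices"
  then have "u \<bullet> (A *v u) = 0" for u
    by (metis add_eq_0_iff2 double_zero inner_commute skew_matrices_iff_inner)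
  then show "affine_motion x (A, t) \<in> (rigidity_row x ` all_edges)\<^sup>\<bottom>"
    by (simp add: affine_motion_def infinitesimal_isometry_iff
        matrix_vector_mult_diff_distrib[symmetric])
qed

lemma dim_infinitesimal_isometries:
  fixes x :: "real ^ ('v::finite \<times> 'n::finite)"
  assumes hull: "affine hull range (point x) = UNIV"
  shows "dim ((rigidity_row x ` all_edges)\<^sup>\<bottom>) = (CARD('n) + 1) choose 2"
proof -
  have "dim (affine_motion x ` (skew_matrices \<times> UNIV))
      = dim ((skew_matrices :: (real ^ 'n ^ 'n) set) \<times> (UNIV :: (real ^ 'n) set))"
    using inj_affine_motion[OF hull]
    by (rule dim_image_eq[OF linear_affine_motion inj_on_subset]) simp
  also have "\<dots> = (CARD('n) choose 2) + CARD('n)"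
    by (subst dim_Times) (simp_all add: subspace_skew_matrices dim_skew_matrices)
  also have "\<dots> = (CARD('n) + 1) choose 2"
    by (simp add: numeral_2_eq_2)
  finally show ?thesis
    unfolding infinitesimal_isometries_eq[OF hull] .
qed

lemma rigidity_rank_all_edges:
  fixes x :: "real ^ ('v::finite \<times> 'n::finite)"
  assumes "affine hull range (point x) = UNIV"
  shows "rigidity_rank all_edges x + ((CARD('n) + 1) choose 2) = CARD('n) * CARD('v)"
  using dim_orthogonal_comp[of "rigidity_row x ` all_edges"]
  by (simp add: rigidity_rank_def dim_infinitesimal_isometries[OF assms] mult.commute)

section \<open>Rigidity and the rank of the rigidity matrix\<close>

definition half_sq_length :: "'v set \<Rightarrow> real ^ ('v::finite \<times> 'n::finite) \<Rightarrow> real" where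
  "half_sq_length e x = edge_inner (point x) (point x) e / 2"

lemma has_derivative_half_sq_length:
  fixes x :: "real ^ ('v::finite \<times> 'n::finite)"
  shows "(half_sq_length e has_derivative (\<lambda>h. rigidity_row x e \<bullet> h)) (at x)"
proof -
  have "((\<lambda>x. rigidity_row x e \<bullet> x / 2) has_derivative
      (\<lambda>h. (rigidity_row x e \<bullet> h + rigidity_row h e \<bullet> x) / 2)) (at x)"
    by (auto intro!: derivative_eq_intros
        bounded_linear.has_derivative[OF bounded_linear_rigidity_row])
  moreover have "rigidity_row h e \<bullet> x = rigidity_row x e \<bullet> h" for h
    by (simp add: inner_rigidity_row edge_inner_commute)
  moreover have "half_sq_length e = (\<lambda>x :: real ^ ('v \<times> 'n). rigidity_row x e \<bullet> x / 2)"
    by (simp add: fun_eq_iff half_sq_length_def inner_rigidity_row)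
  ultimately show ?thesis by simp
qed

lemma equivalent_frameworks_iff_half_sq_length:
  assumes "E \<subseteq> all_edges"
  shows "equivalent_frameworks E (point x) (point y) \<longleftrightarrow>
    (\<forall>e\<in>E. half_sq_length e y = half_sq_length e x)"
proof -
  have pair: "half_sq_length {v, w} y = half_sq_length {v, w} x \<longleftrightarrow>
      dist (point x v) (point x w) = dist (point y v) (point y w)" if "v \<noteq> w" for v w
    using that by (auto simp: half_sq_length_def edge_inner_pair dist_norm norm_eq_sqrt_inner)
  have "v \<noteq> w" if "{v, w} \<in> E" for v w
    using that assms by auto
  moreover have "\<exists>v w. e = {v, w}" if "e \<in> E" for e
    using that assms unfolding card_2_iff by blast
  ultimately show ?thesis
    unfolding equivalent_frameworks_def using pair by metis
qed

lemma equivalent_frameworks_all_edges_iff: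
  "equivalent_frameworks all_edges p q \<longleftrightarrow> (\<forall>v w. dist (p v) (p w) = dist (q v) (q w))"
  unfolding equivalent_frameworks_def by (auto simp: card_2_iff) (metis dist_self)

lemma rigid_framework_iff_congruent:
  fixes p :: "'v::finite \<Rightarrow> real ^ 'n::finite"
  assumes hull: "affine hull range p = UNIV"
  shows "rigid_framework E p \<longleftrightarrow>
    (\<exists>\<epsilon>>0. \<forall>q. (\<forall>v. dist (p v) (q v) < \<epsilon>) \<and> equivalent_frameworks E p q \<longrightarrow>
       equivalent_frameworks all_edges p q)"
proof -
  have "(\<exists>T. (\<forall>y z. dist (T y) (T z) = dist y z) \<and> (\<forall>v. q v = T (p v))) \<longleftrightarrow>
      equivalent_frameworks all_edges p q" for q
  proof
    assume "equivalent_frameworks all_edges p q"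
    then show "\<exists>T. (\<forall>y z. dist (T y) (T z) = dist y z) \<and> (\<forall>v. q v = T (p v))"
      using isometry_of_congruent[OF hull] unfolding equivalent_frameworks_all_edges_iff by metis
  qed (auto simp: equivalent_frameworks_all_edges_iff)
  then show ?thesis
    unfolding rigid_framework_def by simp
qed

lemma rigid_framework_iff_eventually_congruent:
  fixes x :: "real ^ ('v::finite \<times> 'n::finite)"
  assumes hull: "affine hull range (point x) = UNIV"
  shows "rigid_framework E (point x) \<longleftrightarrow>
    (\<forall>\<^sub>F y in nhds x. equivalent_frameworks E (point x) (point y) \<longrightarrow>
       equivalent_frameworks all_edges (point x) (point y))"
  unfolding rigid_framework_iff_congruent[OF hull] eventually_nhds_metric
proof safe
  fix \<epsilon> :: real
  assume "\<epsilon> > 0" and close: "\<forall>q. (\<forall>v. dist (point x v) (q v) < \<epsilon>) \<and>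
      equivalent_frameworks E (point x) q \<longrightarrow> equivalent_frameworks all_edges (point x) q"
  have "dist (point x v) (point y v) < \<epsilon>" if "dist y x < \<epsilon>" for y v
    using dist_point_le[of x v y] that by (simp add: dist_commute)
  then show "\<exists>\<delta>>0. \<forall>y. dist y x < \<delta> \<longrightarrow> equivalent_frameworks E (point x) (point y) \<longrightarrow>
      equivalent_frameworks all_edges (point x) (point y)"
    using \<open>\<epsilon> > 0\<close> close by (intro exI[of _ \<epsilon>]) blast
next
  fix \<delta> :: real
  assume \<delta>: "\<delta> > 0" and close: "\<forall>y. dist y x < \<delta> \<longrightarrow> equivalent_frameworks E (point x) (point y) \<longrightarrow>
      equivalent_frameworks all_edges (point x) (point y)"
  define N where "N = real (CARD('v) * CARD('n))"
  have N: "N > 0" by (simp add: N_def)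
  have "dist (config q) x < \<delta>" if "\<forall>v. dist (point x v) (q v) < \<delta> / (2 * N)" for q
  proof -
    have "dist x (config q) \<le> N * (\<delta> / (2 * N))"
      using dist_config_le[of "point x" q "\<delta> / (2 * N)"] that by (simp add: N_def less_imp_le)
    also have "\<dots> < \<delta>"
      using N \<delta> by (simp add: field_simps)
    finally show ?thesis
      by (simp add: dist_commute)
  qed
  then have "equivalent_frameworks all_edges (point x) q"
    if "\<forall>v. dist (point x v) (q v) < \<delta> / (2 * N)" "equivalent_frameworks E (point x) q" for q
    using close[rule_format, of "config q"] that by simp
  then show "\<exists>\<epsilon>>0. \<forall>q. (\<forall>v. dist (point x v) (q v) < \<epsilon>) \<and>
      equivalent_frameworks E (point x) q \<longrightarrow> equivalent_frameworks all_edges (point x) q"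
    using \<delta> N by (intro exI[of _ "\<delta> / (2 * N)"]) simp
qed

text \<open>
  As in the theorem of Asimow and Roth: by genericity, the edges of a maximal independent set of
  rows also span all rows at the neighbouring configurations, so that the rank is locally constant.
\<close>

lemma constant_rank_family_half_sq_length:
  fixes x :: "real ^ ('v::finite \<times> 'n::finite)"
  assumes gen: "generic (point x)" and J: "J \<subseteq> K" "indep_family J (rigidity_row x)"
    and K: "rigidity_row x ` K \<subseteq> span (rigidity_row x ` J)"
  shows "constant_rank_family half_sq_length (\<lambda>e y. rigidity_row y e) J K
    {y. indep_family J (rigidity_row y)} x"
proof
  show "open {y :: real ^ ('v \<times> 'n). indep_family J (rigidity_row y)}"
    by (intro open_indep_family continuous_on_id
        bounded_linear.continuous_on[OF bounded_linear_rigidity_row])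
  show "continuous_on {y. indep_family J (rigidity_row y)} (\<lambda>y. rigidity_row y e)" for e
    by (intro bounded_linear.continuous_on[OF bounded_linear_rigidity_row] continuous_on_id)
  show "rigidity_row y e \<in> span (rigidity_row y ` J)"
    if "e \<in> K" "y \<in> {y. indep_family J (rigidity_row y)}" for e and y :: "real ^ ('v \<times> 'n)"
    using in_span_if_in_span_at_alg_indep[where r = rigidity_row, OF rat_poly_fun_rigidity_row,
        of x J y e]
      gen that K by (auto simp: generic_point)
qed (use J has_derivative_half_sq_length in auto)

lemma rigidity_row_orthogonal_velocity:
  assumes \<gamma>: "\<gamma> 0 = x" "(\<gamma> has_vector_derivative u) (at 0)"
    and const: "\<forall>\<^sub>F t in at 0. half_sq_length e (\<gamma> t) = half_sq_length e x"
  shows "rigidity_row x e \<bullet> u = 0"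
proof -
  have "((\<lambda>t. half_sq_length e (\<gamma> t)) has_derivative (\<lambda>s. rigidity_row x e \<bullet> (s *\<^sub>R u))) (at 0)"
    using has_derivative_compose[OF \<gamma>(2)[unfolded has_vector_derivative_def]]
      has_derivative_half_sq_length[of e x] \<gamma>(1) by blast
  moreover have "\<forall>\<^sub>F t in at 0. half_sq_length e x = half_sq_length e (\<gamma> t)"
    using const by eventually_elim simp
  then have "((\<lambda>t. half_sq_length e (\<gamma> t)) has_derivative (\<lambda>s. 0)) (at 0)"
    by (rule has_derivative_transform_eventually[OF has_derivative_const]) (simp_all add: \<gamma>(1))
  ultimately have "(\<lambda>s. rigidity_row x e \<bullet> (s *\<^sub>R u)) = (\<lambda>s. 0)"
    by (rule has_derivative_unique)
  from fun_cong[OF this, of 1] show ?thesis by simp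
qed

lemma orthogonal_comp_subset_if_rigid_framework:
  fixes x :: "real ^ ('v::finite \<times> 'n::finite)"
  assumes gen: "generic (point x)" and hull: "affine hull range (point x) = UNIV"
    and E: "E \<subseteq> all_edges" and rigid: "rigid_framework E (point x)"
  shows "(rigidity_row x ` E)\<^sup>\<bottom> \<subseteq> (rigidity_row x ` all_edges)\<^sup>\<bottom>"
proof
  fix u assume u: "u \<in> (rigidity_row x ` E)\<^sup>\<bottom>"
  obtain J where J: "J \<subseteq> E" "indep_family J (rigidity_row x)"
      "rigidity_row x ` E \<subseteq> span (rigidity_row x ` J)"
    by (rule indep_family_spanning_subset)
  interpret constant_rank_family half_sq_length "\<lambda>e y. rigidity_row y e" J E
      "{y. indep_family J (rigidity_row y)}" x
    using gen J by (rule constant_rank_family_half_sq_length)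
  have "rigidity_row x e \<bullet> u = 0" if "e \<in> J" for e
    using u J(1) that by (auto simp: orthogonal_comp_def orthogonal_def)
  then obtain \<gamma> where \<gamma>: "\<gamma> 0 = x" "(\<gamma> has_vector_derivative u) (at 0)"
      "\<forall>\<^sub>F t in at 0. \<forall>e\<in>E. half_sq_length e (\<gamma> t) = half_sq_length e x"
    by (rule level_set_curve)
  have "(\<gamma> \<longlongrightarrow> x) (at 0)"
    using has_vector_derivative_continuous[OF \<gamma>(2)] \<gamma>(1) by (simp add: continuous_at)
  then have "\<forall>\<^sub>F t in at 0. equivalent_frameworks E (point x) (point (\<gamma> t)) \<longrightarrow>
      equivalent_frameworks all_edges (point x) (point (\<gamma> t))"
    using rigid unfolding rigid_framework_iff_eventually_congruent[OF hull]
    by (rule eventually_compose_filterlim[rotated])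
  with \<gamma>(3) have "\<forall>\<^sub>F t in at 0. half_sq_length e (\<gamma> t) = half_sq_length e x"
    if "e \<in> all_edges" for e
    by eventually_elim (use that in \<open>simp add: equivalent_frameworks_iff_half_sq_length E\<close>)
  then have "rigidity_row x e \<bullet> u = 0" if "e \<in> all_edges" for e
    using rigidity_row_orthogonal_velocity[OF \<gamma>(1,2)] that by blast
  then show "u \<in> (rigidity_row x ` all_edges)\<^sup>\<bottom>"
    by (auto simp: orthogonal_comp_def orthogonal_def)
qed

lemma rigid_framework_if_rows_in_span:
  fixes x :: "real ^ ('v::finite \<times> 'n::finite)"
  assumes gen: "generic (point x)" and hull: "affine hull range (point x) = UNIV"
    and E: "E \<subseteq> all_edges" and rows: "rigidity_row x ` all_edges \<subseteq> span (rigidity_row x ` E)"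
  shows "rigid_framework E (point x)"
proof -
  obtain J where J: "J \<subseteq> E" "indep_family J (rigidity_row x)"
      "rigidity_row x ` E \<subseteq> span (rigidity_row x ` J)"
    by (rule indep_family_spanning_subset)
  have "rigidity_row x ` all_edges \<subseteq> span (rigidity_row x ` J)"
    using rows span_minimal[OF J(3)] by blast
  moreover have "J \<subseteq> all_edges"
    using J(1) E by blast
  ultimately interpret constant_rank_family half_sq_length "\<lambda>e y. rigidity_row y e" J all_edges
      "{y. indep_family J (rigidity_row y)}" x
    using gen J(2) by (intro constant_rank_family_half_sq_length)
  have "\<forall>\<^sub>F y in nhds x. equivalent_frameworks E (point x) (point y) \<longrightarrow>
      equivalent_frameworks all_edges (point x) (point y)"
    using eventually_level_set_subset
    by eventually_elim (use J(1) in \<open>auto simp: equivalent_frameworks_iff_half_sq_length E\<close>)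
  then show ?thesis
    by (simp add: rigid_framework_iff_eventually_congruent[OF hull])
qed

lemma rigid_framework_iff_rank:
  fixes x :: "real ^ ('v::finite \<times> 'n::finite)"
  assumes gen: "generic (point x)" and hull: "affine hull range (point x) = UNIV"
    and E: "E \<subseteq> all_edges"
  shows "rigid_framework E (point x) \<longleftrightarrow> rigidity_rank E x = rigidity_rank all_edges x"
proof
  assume "rigid_framework E (point x)"
  then have "(rigidity_row x ` E)\<^sup>\<bottom> = (rigidity_row x ` all_edges)\<^sup>\<bottom>"
    using orthogonal_comp_subset_if_rigid_framework[OF gen hull E]
      orthogonal_comp_anti_mono[OF image_mono[OF E]] by blast
  then show "rigidity_rank E x = rigidity_rank all_edges x"
    using dim_orthogonal_comp[of "rigidity_row x ` E"]
      dim_orthogonal_comp[of "rigidity_row x ` all_edges"]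
    by (simp add: rigidity_rank_def)
next
  assume "rigidity_rank E x = rigidity_rank all_edges x"
  then have "span (rigidity_row x ` E) = span (rigidity_row x ` all_edges)"
    using E by (intro dim_eq_span) (auto simp: rigidity_rank_def)
  then show "rigid_framework E (point x)"
    using span_superset rigid_framework_if_rows_in_span[OF gen hull E] by metis
qed

lemma rigidity_rank_upper_bound:
  fixes x :: "real ^ ('v::finite \<times> 'n::finite)"
  assumes card: "CARD('n) < CARD('v)" and E: "E \<subseteq> all_edges"
  shows "rigidity_rank E x + ((CARD('n) + 1) choose 2) \<le> CARD('n) * CARD('v)"
proof -
  obtain y :: "real ^ ('v \<times> 'n)" where y: "generic (point y)"
    using generic_exists by blast
  have "rigidity_rank E x \<le> rigidity_rank all_edges y"
    using rigidity_rank_le_generic[OF y] rigidity_rank_mono[OF E] by (rule order_trans)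
  then show ?thesis
    using rigidity_rank_all_edges[OF generic_affinely_spanning[OF y card]] by linarith
qed

lemma graph_rigid_iff_rank:
  fixes E :: "'v::finite set set"
  assumes card: "CARD('n::finite) < CARD('v)" and E: "E \<subseteq> all_edges"
  shows "graph_rigid TYPE('n) E \<longleftrightarrow>
    (\<exists>x :: real ^ ('v \<times> 'n). rigidity_rank E x + ((CARD('n) + 1) choose 2) = CARD('n) * CARD('v))"
    (is "_ \<longleftrightarrow> (\<exists>x. ?full x)")
proof -
  have rank: "rigid_framework E (point x) \<longleftrightarrow> ?full x" if "generic (point x)" for x
    using rigid_framework_iff_rank[OF that _ E] rigidity_rank_all_edges[of x]
      generic_affinely_spanning[OF that card] by auto
  show ?thesis
  proof
    assume "graph_rigid TYPE('n) E"
    then obtain p :: "'v \<Rightarrow> real ^ 'n"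
      where "generic (point (config p))" "rigid_framework E (point (config p))"
      by (auto simp: graph_rigid_def)
    then show "\<exists>x. ?full x"
      using rank by blast
  next
    assume "\<exists>x. ?full x"
    then obtain x where "?full x" ..
    moreover obtain y :: "real ^ ('v \<times> 'n)" where y: "generic (point y)"
      using generic_exists by blast
    ultimately have "?full y"
      using rigidity_rank_le_generic[OF y, of E x] rigidity_rank_upper_bound[OF card E, of y]
      by linarith
    then show "graph_rigid TYPE('n) E"
      unfolding graph_rigid_def using y rank by blast
  qed
qed

lemma graph_rigid_mono:
  fixes E F :: "'v::finite set set"
  assumes card: "CARD('n::finite) < CARD('v)" and E: "E \<subseteq> all_edges" and F: "F \<subseteq> E"
    and rigid: "graph_rigid TYPE('n) F"
  shows "graph_rigid TYPE('n) E"
proof -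
  obtain x :: "real ^ ('v \<times> 'n)"
    where x: "rigidity_rank F x + ((CARD('n) + 1) choose 2) = CARD('n) * CARD('v)"
    using rigid graph_rigid_iff_rank[OF card order_trans[OF F E]] by blast
  then have "rigidity_rank E x + ((CARD('n) + 1) choose 2) = CARD('n) * CARD('v)"
    using rigidity_rank_mono[OF F, of x] rigidity_rank_upper_bound[OF card E, of x] by linarith
  then show ?thesis
    using graph_rigid_iff_rank[OF card E] by blast
qed

section \<open>The rank of \<open>J\<close>\<close>

definition join_coords ::
  "real ^ ('v::finite \<times> 'm::finite) \<Rightarrow> ('k::finite \<Rightarrow> 'v \<Rightarrow> real) \<Rightarrow> 'v \<Rightarrow> real ^ ('m + 'k)" where
  "join_coords x X v = (\<chi> c. case c of Inl j \<Rightarrow> x $ (v, j) | Inr i \<Rightarrow> X i v)"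

lemma join_coords_Inl [simp]: "join_coords x X v $ Inl j = x $ (v, j)"
  and join_coords_Inr [simp]: "join_coords x X v $ Inr i = X i v"
  by (simp_all add: join_coords_def)

lemma join_coords_surj:
  fixes p :: "'v::finite \<Rightarrow> real ^ ('m::finite + 'k::finite)"
  obtains x X where "p = join_coords x X"
proof
  show "p = join_coords (\<chi> c. p (fst c) $ Inl (snd c)) (\<lambda>i v. p v $ Inr i)"
    by (auto simp: fun_eq_iff vec_eq_iff join_coords_def split: sum.split)
qed

lemma edge_inner_join_coords:
  fixes x z :: "real ^ ('v::finite \<times> 'm::finite)" and X Z :: "'k::finite \<Rightarrow> 'v \<Rightarrow> real"
  shows "edge_inner (join_coords x X) (join_coords z Z) e =
    edge_inner (point x) (point z) e + (\<Sum>i\<in>UNIV. edge_inner (X i) (Z i) e)"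
  unfolding edge_inner_vec UNIV_Plus_UNIV[symmetric]
  by (subst sum.Plus) (simp_all add: point_def)

definition extended_row ::
  "real ^ ('v::finite \<times> 'm::finite) \<Rightarrow> ('k::finite \<Rightarrow> 'v \<Rightarrow> real) \<Rightarrow> 'v set \<Rightarrow>
     (real ^ ('v \<times> 'm)) \<times> (real ^ 'k)" where
  "extended_row x X e = (rigidity_row x e, \<chi> i. edge_inner (X i) (X i) e)"

definition extended_rank ::
  "'v::finite set set \<Rightarrow> real ^ ('v \<times> 'm::finite) \<Rightarrow> ('k::finite \<Rightarrow> 'v \<Rightarrow> real) \<Rightarrow> nat" where
  "extended_rank E x X = dim (extended_row x X ` E)"

subsection \<open>The kernel of \<open>J\<close>\<close>

lemma inner_J_row_Inl: "J_row v0 p (Inl e) \<bullet> y = edge_inner p (point y) e"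
proof -
  have "J_row v0 p (Inl e) = rigidity_row (config p) e"
    by (auto simp: J_row_def rigidity_row_def config_def vec_eq_iff)
  then show ?thesis
    by (simp add: inner_rigidity_row)
qed

lemma inner_J_row_Inr:
  assumes "v \<noteq> v0"
  shows "J_row v0 p (Inr (v, i)) \<bullet> y =
    y $ (v, Inr i) / p v0 $ Inr i - p v $ Inr i * y $ (v0, Inr i) / (p v0 $ Inr i)\<^sup>2"
proof -
  have "J_row v0 p (Inr (v, i)) = (1 / p v0 $ Inr i) *\<^sub>R axis (v, Inr i) 1
      - (p v $ Inr i / (p v0 $ Inr i)\<^sup>2) *\<^sub>R axis (v0, Inr i) 1"
    using assms by (auto simp: J_row_def vec_eq_iff axis_def)
  then show ?thesis
    by (simp add: inner_diff_left inner_axis')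
qed

lemma J_kernel_iff:
  fixes p :: "'v::finite \<Rightarrow> real ^ ('m::finite + 'k::finite)"
  assumes p0: "\<forall>i. p v0 $ Inr i \<noteq> 0"
  shows "y \<in> (J_row v0 p ` J_row_indices v0 E)\<^sup>\<bottom> \<longleftrightarrow>
    (\<forall>e\<in>E. edge_inner p (point y) e = 0) \<and>
    (\<forall>v i. y $ (v, Inr i) = y $ (v0, Inr i) / p v0 $ Inr i * p v $ Inr i)"
proof -
  have "J_row v0 p (Inr (v, i)) \<bullet> y = 0 \<longleftrightarrow>
      y $ (v, Inr i) = y $ (v0, Inr i) / p v0 $ Inr i * p v $ Inr i" if "v \<noteq> v0" for v i
    using p0 by (simp add: inner_J_row_Inr[OF that] field_simps power2_eq_square)
  moreover have "y $ (v0, Inr i) = y $ (v0, Inr i) / p v0 $ Inr i * p v0 $ Inr i" for i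
    using p0 by simp
  ultimately have "(\<forall>v i. v \<noteq> v0 \<longrightarrow> J_row v0 p (Inr (v, i)) \<bullet> y = 0) \<longleftrightarrow>
      (\<forall>v i. y $ (v, Inr i) = y $ (v0, Inr i) / p v0 $ Inr i * p v $ Inr i)"
    by metis
  moreover have "y \<in> (J_row v0 p ` J_row_indices v0 E)\<^sup>\<bottom> \<longleftrightarrow>
      (\<forall>e\<in>E. J_row v0 p (Inl e) \<bullet> y = 0) \<and> (\<forall>v i. v \<noteq> v0 \<longrightarrow> J_row v0 p (Inr (v, i)) \<bullet> y = 0)"
    by (auto simp: orthogonal_comp_def orthogonal_def J_row_indices_def)
  ultimately show ?thesis
    by (simp add: inner_J_row_Inl)
qed

definition kernel_lift ::
  "('k::finite \<Rightarrow> 'v::finite \<Rightarrow> real) \<Rightarrow> (real ^ ('v \<times> 'm::finite)) \<times> (real ^ 'k) \<Rightarrow>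
     real ^ ('v \<times> ('m + 'k))" where
  "kernel_lift X = (\<lambda>(z, l). config (join_coords z (\<lambda>i v. l $ i * X i v)))"

lemma linear_kernel_lift: "linear (kernel_lift X)"
  by (rule linearI)
    (auto simp: kernel_lift_def config_def join_coords_def vec_eq_iff algebra_simps
      split: sum.split)

lemma inj_kernel_lift:
  assumes "\<forall>i. X i v0 \<noteq> 0"
  shows "inj (kernel_lift X)"
  unfolding linear_injective_0[OF linear_kernel_lift]
proof (intro allI impI)
  fix y assume "kernel_lift X y = 0"
  moreover obtain z l where y: "y = (z, l)" by force
  ultimately have zero: "join_coords z (\<lambda>i v. l $ i * X i v) v $ c = 0" for v c
    by (simp add: kernel_lift_def config_def vec_eq_iff)
  have "z $ (v, j) = 0" for v j
    using zero[of v "Inl j"] by simp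
  moreover have "l $ i = 0" for i
    using zero[of v0 "Inr i"] assms by simp
  ultimately show "y = 0"
    by (simp add: y vec_eq_iff zero_prod_def)
qed

lemma edge_inner_kernel_lift:
  "edge_inner (join_coords x X) (point (kernel_lift X (z, l))) e = extended_row x X e \<bullet> (z, l)"
proof -
  have "edge_inner (X i) (\<lambda>v. l $ i * X i v) e = edge_inner (X i) (X i) e * l $ i" for i
    by (simp add: edge_inner_def sum_distrib_left mult_ac)
  then show ?thesis
    by (simp add: kernel_lift_def edge_inner_join_coords extended_row_def inner_rigidity_row)
      (simp add: inner_vec_def)
qed

lemma J_kernel_eq:
  assumes X0: "\<forall>i. X i v0 \<noteq> 0"
  shows "(J_row v0 (join_coords x X) ` J_row_indices v0 E)\<^sup>\<bottom> =
    kernel_lift X ` ((extended_row x X ` E)\<^sup>\<bottom>)"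
proof -
  have lift_iff: "kernel_lift X (z, l) \<in> (J_row v0 (join_coords x X) ` J_row_indices v0 E)\<^sup>\<bottom>
      \<longleftrightarrow> (z, l) \<in> (extended_row x X ` E)\<^sup>\<bottom>" for z l
  proof -
    have "kernel_lift X (z, l) $ (v, Inr i) = l $ i * X i v" for v i
      by (simp add: kernel_lift_def config_def)
    then have "kernel_lift X (z, l) \<in> (J_row v0 (join_coords x X) ` J_row_indices v0 E)\<^sup>\<bottom>
        \<longleftrightarrow> (\<forall>e\<in>E. extended_row x X e \<bullet> (z, l) = 0)"
      using X0 by (simp add: J_kernel_iff edge_inner_kernel_lift)
    then show ?thesis
      by (simp add: orthogonal_comp_def orthogonal_def)
  qed
  show ?thesis
  proof (intro equalityI subsetI)
    fix y assume y: "y \<in> (J_row v0 (join_coords x X) ` J_row_indices v0 E)\<^sup>\<bottom>"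
    define z where "z = (\<chi> c. y $ (fst c, Inl (snd c)))"
    define l where "l = (\<chi> i. y $ (v0, Inr i) / X i v0)"
    have "y $ (v, Inr i) = y $ (v0, Inr i) / X i v0 * X i v" for v i
      using y X0 J_kernel_iff[of "join_coords x X" v0 y E] unfolding join_coords_Inr by blast
    then have "y $ (v, Inr i) = l $ i * X i v" for v i
      unfolding l_def vec_lambda_beta .
    then have "y $ c = kernel_lift X (z, l) $ c" for c
      by (cases c; cases "snd c") (simp_all add: kernel_lift_def config_def z_def)
    then have "y = kernel_lift X (z, l)"
      by (simp add: vec_eq_iff)
    moreover from this have "(z, l) \<in> (extended_row x X ` E)\<^sup>\<bottom>"
      using y lift_iff by simp
    ultimately show "y \<in> kernel_lift X ` ((extended_row x X ` E)\<^sup>\<bottom>)"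
      by (rule image_eqI)
  qed (use lift_iff in auto)
qed

lemma J_rank_eq_extended_rank:
  fixes x :: "real ^ ('v::finite \<times> 'm::finite)" and X :: "'k::finite \<Rightarrow> 'v \<Rightarrow> real"
  assumes X0: "\<forall>i. X i v0 \<noteq> 0"
  shows "J_rank v0 E (join_coords x X) + CARD('m) * CARD('v) + CARD('k) =
    CARD('m + 'k) * CARD('v) + extended_rank E x X"
proof -
  let ?rows = "J_row v0 (join_coords x X) ` J_row_indices v0 E"
  have "inj (kernel_lift X :: (real ^ ('v \<times> 'm)) \<times> (real ^ 'k) \<Rightarrow> _)"
    by (rule inj_kernel_lift[of X v0, OF X0])
  then have "dim (kernel_lift X ` ((extended_row x X ` E)\<^sup>\<bottom>)) = dim ((extended_row x X ` E)\<^sup>\<bottom>)"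
    by (rule dim_image_eq[OF linear_kernel_lift inj_on_subset]) simp
  then have "dim (?rows\<^sup>\<bottom>) = dim ((extended_row x X ` E)\<^sup>\<bottom>)"
    by (simp add: J_kernel_eq X0)
  then show ?thesis
    using dim_orthogonal_comp[of ?rows] dim_orthogonal_comp[of "extended_row x X ` E"]
    by (simp add: J_rank_def extended_rank_def mult.commute)
qed

lemma extended_rank_shift: "extended_rank E x (\<lambda>i v. X i v + c i) = extended_rank E x X"
  by (simp add: extended_rank_def extended_row_def edge_inner_shift)

lemma inf_dk_rigid_iff_extended_rank:
  fixes x :: "real ^ ('v::finite \<times> 'm::finite)" and X :: "'k::finite \<Rightarrow> 'v \<Rightarrow> real"
  assumes "\<not> complete_graph E"
  shows "inf_dk_rigid v0 E (join_coords x X) \<longleftrightarrow> (\<forall>i. X i v0 \<noteq> 0) \<and>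
    extended_rank E x X + ((CARD('m) + 1) choose 2) = CARD('m) * CARD('v) + CARD('k)"
proof (cases "\<forall>i. X i v0 \<noteq> 0")
  case True
  define M where "M = CARD('m + 'k) * CARD('v)"
  have rank: "J_rank v0 E (join_coords x X) + CARD('m) * CARD('v) + CARD('k) =
      M + extended_rank E x X"
    unfolding M_def using True by (rule J_rank_eq_extended_rank)
  have "inf_dk_rigid v0 E (join_coords x X) \<longleftrightarrow>
      int (J_rank v0 E (join_coords x X)) = int M - int ((CARD('m) + 1) choose 2)"
    using True assms by (simp add: inf_dk_rigid_def M_def)
  also have "\<dots> \<longleftrightarrow> J_rank v0 E (join_coords x X) + ((CARD('m) + 1) choose 2) = M"
    by (intro iffI) linarith+
  also have "\<dots> \<longleftrightarrow> extended_rank E x X + ((CARD('m) + 1) choose 2) = CARD('m) * CARD('v) + CARD('k)"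
    using rank by (intro iffI) linarith+
  finally show ?thesis
    using True by simp
qed (auto simp: inf_dk_rigid_def assms)

lemma dk_rigid_iff_extended_rank:
  fixes E :: "'v::finite set set"
  assumes "\<not> complete_graph E"
  shows "dk_rigid TYPE('m::finite) TYPE('k::finite) v0 E \<longleftrightarrow>
    (\<exists>(x :: real ^ ('v \<times> 'm)) (X :: 'k \<Rightarrow> 'v \<Rightarrow> real).
       extended_rank E x X + ((CARD('m) + 1) choose 2) = CARD('m) * CARD('v) + CARD('k))"
    (is "_ \<longleftrightarrow> (\<exists>x X. ?full x X)")
proof
  assume "dk_rigid TYPE('m) TYPE('k) v0 E"
  then obtain x :: "real ^ ('v \<times> 'm)" and X :: "'k \<Rightarrow> 'v \<Rightarrow> real"
    where "inf_dk_rigid v0 E (join_coords x X)"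
    unfolding dk_rigid_def using join_coords_surj by metis
  then show "\<exists>x X. ?full x X"
    using inf_dk_rigid_iff_extended_rank[OF assms] by blast
next
  assume "\<exists>x X. ?full x X"
  then obtain x X where full: "?full x X"
    by blast
  define Y where "Y = (\<lambda>i v. X i v + (1 - X i v0))"
  have "extended_rank E x Y = extended_rank E x X"
    unfolding Y_def by (rule extended_rank_shift)
  then have "inf_dk_rigid v0 E (join_coords x Y)"
    using full by (simp add: inf_dk_rigid_iff_extended_rank[OF assms] Y_def)
  then show "dk_rigid TYPE('m) TYPE('k) v0 E"
    unfolding dk_rigid_def by blast
qed

section \<open>Attaining the rank with additional columns\<close>

lemma edge_weights_zero_if_orthogonal_to_squares:
  fixes E :: "'v::finite set set" and \<omega> :: "'v set \<Rightarrow> real"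
  assumes E: "E \<subseteq> all_edges" and zero: "\<And>f :: 'v \<Rightarrow> real. (\<Sum>e\<in>E. \<omega> e * edge_inner f f e) = 0"
    and e0: "e0 \<in> E"
  shows "\<omega> e0 = 0"
proof -
  obtain v w where vw: "e0 = {v, w}" "v \<noteq> w"
    using E e0 unfolding card_2_iff by blast
  let ?q = "\<lambda>S e. edge_inner (indicat_real S) (indicat_real S) e"
  have "?q {v} e + ?q {w} e - ?q {v, w} e = (if e = e0 then 2 else 0)" if e: "e \<in> E" for e
  proof -
    obtain a b where "e = {a, b}" "a \<noteq> b"
      using E e unfolding card_2_iff by blast
    then show ?thesis
      using vw by (auto simp: edge_inner_pair doubleton_eq_iff indicator_def)
  qed
  then have "(\<Sum>e\<in>E. \<omega> e * (?q {v} e + ?q {w} e - ?q {v, w} e))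
      = (\<Sum>e\<in>E. \<omega> e * (if e = e0 then 2 else 0))"
    by (intro sum.cong) simp_all
  also have "\<dots> = 2 * \<omega> e0"
    using e0 by (simp add: if_distrib[of "\<lambda>s. _ * s"] cong: if_cong)
  finally show ?thesis
    by (simp add: distrib_left right_diff_distrib sum.distrib sum_subtractf zero)
qed

lemma extended_rank_attained:
  fixes E :: "'v::finite set set" and x :: "real ^ ('v \<times> 'm::finite)"
  assumes E: "E \<subseteq> all_edges" and card: "rigidity_rank E x + CARD('k::finite) \<le> card E"
  obtains X :: "'k::finite \<Rightarrow> 'v \<Rightarrow> real" where "extended_rank E x X = rigidity_rank E x + CARD('k)"
proof -
  obtain G :: "'k \<Rightarrow> 'v set \<Rightarrow> real" where G: "range G \<subseteq> range (\<lambda>f :: 'v \<Rightarrow> real. edge_inner f f)"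
      "dim (adjoin_columns (rigidity_row x) UNIV G ` E) = dim (rigidity_row x ` E) + CARD('k)"
  proof (rule dim_adjoin_columns_attained)
    show "\<forall>e\<in>E. \<omega> e = 0"
      if "\<And>g. g \<in> range (\<lambda>f :: 'v \<Rightarrow> real. edge_inner f f) \<Longrightarrow> (\<Sum>e\<in>E. \<omega> e * g e) = 0" for \<omega>
      using edge_weights_zero_if_orthogonal_to_squares[OF E] that by blast
    show "dim (rigidity_row x ` E) + CARD('k) \<le> card E"
      using card by (simp add: rigidity_rank_def)
  qed (use that in simp_all)
  have "\<exists>f :: 'v \<Rightarrow> real. G i = edge_inner f f" for i
    using G(1) by blast
  then obtain X :: "'k \<Rightarrow> 'v \<Rightarrow> real" where "\<And>i. G i = edge_inner (X i) (X i)"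
    by metis
  then have "adjoin_columns (rigidity_row x) UNIV G = extended_row x X"
    by (simp add: fun_eq_iff adjoin_columns_def extended_row_def)
  then show thesis
    using that[of X] G(2) by (simp add: extended_rank_def rigidity_rank_def)
qed

lemma extended_rank_le_rigidity_rank:
  fixes x :: "real ^ ('v::finite \<times> 'm::finite)" and X :: "'k::finite \<Rightarrow> 'v \<Rightarrow> real"
  shows "extended_rank E x X \<le> rigidity_rank E x + CARD('k)"
proof -
  have "extended_row x X ` E \<subseteq> span (rigidity_row x ` E) \<times> UNIV"
    by (auto simp: extended_row_def intro: span_base)
  then have "extended_rank E x X \<le> dim (span (rigidity_row x ` E) \<times> (UNIV :: (real ^ 'k) set))"
    unfolding extended_rank_def by (rule dim_subset)
  also have "\<dots> = rigidity_rank E x + CARD('k)"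
    by (subst dim_Times) (simp_all add: rigidity_rank_def)
  finally show ?thesis .
qed

lemma extended_rank_le_card:
  fixes E :: "'v::finite set set"
  shows "extended_rank E x X \<le> card E"
proof -
  have "extended_rank E x X \<le> card (extended_row x X ` E)"
    unfolding extended_rank_def by (rule dim_le_card') simp
  also have "\<dots> \<le> card E"
    by (rule card_image_le) simp
  finally show ?thesis .
qed

lemma dk_rigid_imp_card_ge:
  fixes E :: "'v::finite set set"
  assumes "\<not> complete_graph E" "dk_rigid TYPE('m::finite) TYPE('k::finite) v0 E"
  shows "CARD('m) * CARD('v) + CARD('k) \<le> card E + ((CARD('m) + 1) choose 2)"
proof -
  obtain x :: "real ^ ('v \<times> 'm)" and X :: "'k \<Rightarrow> 'v \<Rightarrow> real"
    where "extended_rank E x X + ((CARD('m) + 1) choose 2) = CARD('m) * CARD('v) + CARD('k)"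
    using assms dk_rigid_iff_extended_rank by blast
  then show ?thesis
    using extended_rank_le_card[of E x X] by linarith
qed

lemma dk_rigid_iff_graph_rigid:
  fixes E :: "'v::finite set set"
  assumes less: "CARD('m::finite) < CARD('v)" and E: "E \<subseteq> all_edges" "\<not> complete_graph E"
  shows "dk_rigid TYPE('m) TYPE('k::finite) v0 E \<longleftrightarrow> graph_rigid TYPE('m) E \<and>
    CARD('m) * CARD('v) + CARD('k) \<le> card E + ((CARD('m) + 1) choose 2)"
proof
  assume dk: "dk_rigid TYPE('m) TYPE('k) v0 E"
  then obtain x :: "real ^ ('v \<times> 'm)" and X :: "'k \<Rightarrow> 'v \<Rightarrow> real"
    where "extended_rank E x X + ((CARD('m) + 1) choose 2) = CARD('m) * CARD('v) + CARD('k)"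
    using dk_rigid_iff_extended_rank[OF E(2)] by blast
  then have "rigidity_rank E x + ((CARD('m) + 1) choose 2) = CARD('m) * CARD('v)"
    using extended_rank_le_rigidity_rank[of E x X] rigidity_rank_upper_bound[OF less E(1), of x]
    by linarith
  then show "graph_rigid TYPE('m) E \<and>
      CARD('m) * CARD('v) + CARD('k) \<le> card E + ((CARD('m) + 1) choose 2)"
    using graph_rigid_iff_rank[OF less E(1)] dk_rigid_imp_card_ge[OF E(2) dk] by blast
next
  assume rigid: "graph_rigid TYPE('m) E \<and>
      CARD('m) * CARD('v) + CARD('k) \<le> card E + ((CARD('m) + 1) choose 2)"
  then obtain x :: "real ^ ('v \<times> 'm)"
    where x: "rigidity_rank E x + ((CARD('m) + 1) choose 2) = CARD('m) * CARD('v)"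
    using graph_rigid_iff_rank[OF less E(1)] by blast
  have "rigidity_rank E x + CARD('k) \<le> card E"
    using rigid x by linarith
  then obtain X :: "'k \<Rightarrow> 'v \<Rightarrow> real" where "extended_rank E x X = rigidity_rank E x + CARD('k)"
    by (rule extended_rank_attained[OF E(1)])
  then have "extended_rank E x X + ((CARD('m) + 1) choose 2) = CARD('m) * CARD('v) + CARD('k)"
    using x by linarith
  then show "dk_rigid TYPE('m) TYPE('k) v0 E"
    using dk_rigid_iff_extended_rank[OF E(2)] by blast
qed

section \<open>Complete graphs and small dimensions\<close>

lemma complete_graph_dk_rigid:
  fixes E :: "'v::finite set set"
  assumes "complete_graph E"
  shows "dk_rigid TYPE('m::finite) TYPE('k::finite) v0 E"
proof -
  let ?d = "min CARD('m + 'k) (CARD('v) - 1)"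
  obtain B :: "(real ^ ('m + 'k)) set" where B: "B \<subseteq> Basis" "card B = ?d"
    using obtain_subset_with_card_n[of ?d "Basis :: (real ^ ('m + 'k)) set"] by auto
  have "finite B"
    using B(1) finite_Basis finite_subset by blast
  moreover have "card (insert 0 B) \<le> CARD('v)"
    using B(2) card_insert_le_m1[of "CARD('v)" B 0] by simp
  ultimately obtain p :: "'v \<Rightarrow> real ^ ('m + 'k)" where p: "range p = insert 0 B"
    using card_le_inj[of "insert 0 B" "UNIV :: 'v set"]
      inj_on_iff_surj[of "insert 0 B" "UNIV :: 'v set"]
    by auto
  have "aff_dim (insert 0 B) = int (dim (insert 0 B))"
    by (rule aff_dim_zero) (simp add: hull_inc)
  also have "dim (insert 0 B) = card B"
    using independent_mono[OF independent_Basis B(1)]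
    by (simp add: dim_insert span_zero dim_eq_card_independent)
  finally have "inf_dk_rigid v0 E p"
    using assms B(2) p by (simp add: inf_dk_rigid_def)
  then show ?thesis
    unfolding dk_rigid_def by blast
qed

lemma card_less_if_not_complete:
  fixes E :: "'v::finite set set"
  assumes "E \<subseteq> all_edges" "\<not> complete_graph E"
  shows "card E < CARD('v) choose 2"
proof -
  have "card E < card (all_edges :: 'v set set)"
    using assms by (intro psubset_card_mono) (auto simp: complete_graph_def)
  then show ?thesis
    using n_subsets[of "UNIV :: 'v set" 2] by simp
qed

lemma choose_two_add_choose_two:
  fixes m n :: nat
  assumes "n \<le> m"
  shows "(n choose 2) + ((m + 1) choose 2) = m * n + ((m - n + 1) choose 2)"
proof -
  have square: "(n choose 2) + ((n + 1) choose 2) = n * n"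
    by (induction n) (simp_all add: numeral_2_eq_2)
  have "(n choose 2) + ((n + j + 1) choose 2) = (n + j) * n + ((j + 1) choose 2)" for j
  proof (induction j)
    case (Suc j)
    then show ?case by (simp add: numeral_2_eq_2)
  qed (use square in \<open>simp add: numeral_2_eq_2\<close>)
  from this[of "m - n"] show ?thesis
    using assms by simp
qed

lemma less_card_if_many_edges:
  fixes E :: "'v::finite set set"
  assumes E: "E \<subseteq> all_edges" "\<not> complete_graph E" and "m \<le> CARD('v) + 1" "k \<ge> 1"
    and count: "m * CARD('v) + k \<le> card E + ((m + 1) choose 2)"
  shows "m < CARD('v)"
proof (rule ccontr)
  assume "\<not> m < CARD('v)"
  then have "(CARD('v) choose 2) + ((m + 1) choose 2)
      = m * CARD('v) + ((m - CARD('v) + 1) choose 2)"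
    by (intro choose_two_add_choose_two) simp
  moreover have "(m - CARD('v) + 1) choose 2 \<le> 1"
  proof -
    have "m - CARD('v) + 1 = 1 \<or> m - CARD('v) + 1 = 2"
      using assms(3) by linarith
    then show ?thesis by (auto simp: numeral_2_eq_2)
  qed
  ultimately show False
    using card_less_if_not_complete[OF E] count \<open>k \<ge> 1\<close> by linarith
qed

theorem theorem4p3:
  fixes d k :: nat and E :: "'v::finite set set" and v0 :: 'v
  assumes "d \<ge> 2" and "k \<in> {1..d - 1}"
    and "CARD('m::finite) = d - k" and "CARD('k::finite) = k"
    and "simple_graph E"
    and "complete_graph E \<or> d - k \<le> CARD('v) + 1"
  shows "dk_rigid TYPE('m) TYPE('k) v0 E \<longleftrightarrow>
    complete_graph E \<or>
    ((\<exists>F\<subseteq>E. graph_rigid TYPE('m) F) \<and>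
     int (card E) \<ge> int (d - k) * int CARD('v) - int ((d - k + 1) choose 2) + int k)"
proof (cases "complete_graph E")
  case True
  then show ?thesis using complete_graph_dk_rigid by blast
next
  case False
  let ?count = "CARD('m) * CARD('v) + CARD('k) \<le> card E + ((CARD('m) + 1) choose 2)"
  have E: "E \<subseteq> all_edges"
    using assms(5) by (simp add: simple_graph_iff)
  have less: "CARD('m) < CARD('v)" if ?count
    using less_card_if_many_edges[OF E False _ _ that] assms False by simp
  have "dk_rigid TYPE('m) TYPE('k) v0 E \<longleftrightarrow> (\<exists>F\<subseteq>E. graph_rigid TYPE('m) F) \<and> ?count"
    using dk_rigid_imp_card_ge[OF False] dk_rigid_iff_graph_rigid[OF less E False]
      graph_rigid_mono[OF less E] by blast
  moreover have "?count \<longleftrightarrow>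
      int (card E) \<ge> int CARD('m) * int CARD('v) - int ((CARD('m) + 1) choose 2) + int CARD('k)"
    by (subst of_nat_le_iff[symmetric, where 'a = int])
      (simp only: of_nat_add of_nat_mult, linarith)
  ultimately show ?thesis
    using False assms(3,4) by simp
qed

end
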